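(* Let $V:\mathbb{Z}^N\to\mathbb{R}$ be a potential on the lattice graph $\mathbb{Z}^N$ with $\inf_{x\in\mathbb{Z}^N}V(x)>-1$. If $V$ is $T$-periodic in $x$ for some positive integer $T$, then the equation $$-\Delta u+V(x)u=u\log u^2,\quad x\in\mathbb{Z}^N,$$ has a ground state solution $u$. Moreover, $u(x)>0$ for all $x\in\mathbb{Z}^N$ or $u(x)<0$ for all $x\in\mathbb{Z}^N$.
   Context: The lattice graph $\mathbb{Z}^N$ has vertex set $\mathbb{Z}^N$ and edges $\{x,y\}$ with $\sum_{i=1}^N|x_i-y_i|=1$ (written $x\sim y$). A function $g$ on $\mathbb{Z}^N$ is $T$-periodic if $g(x+Te_i)=g(x)$ for all $x\in\mathbb{Z}^N$, $1\le i\le N$, with $e_i$ the $i$-th unit vector. All functions are real valued, $\mu$ is the counting measure, $\int_{\mathbb{Z}^N}f\,d\mu=\sum_{x}f(x)$, $\Delta u(x)=\sum_{y\sim x}(u(y)-u(x))$, $|\nabla u|^2(x)=\frac12\sum_{y\sim x}(u(y)-u(x))^2$. $H^1(\mathbb{Z}^N)$ is the completion of the finitely supported functions under $\left(\int(|\nabla u|^2+u^2)d\mu\right)^{1/2}$, and $X=\{u\in H^1(\mathbb{Z}^N):\int(V+1)u^2\,d\mu<\infty\}$. The energy $J:X\to(-\infty,+\infty]$ is $$J(u)=\frac12\int_{\mathbb{Z}^N}\left(|\nabla u|^2+(V(x)+1)u^2\right)d\mu-\frac12\int_{\mathbb{Z}^N}u^2\log u^2\,d\mu$$ with $0\log 0=0$;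 $D(J)=\{u\in X:J(u)<+\infty\}$. The Nehari manifold is $$\mathcal{N}=\left\{u\in D(J)\setminus\{0\}:\int_{\mathbb{Z}^N}(|\nabla u|^2+V u^2)\,d\mu=\int_{\mathbb{Z}^N}u^2\log u^2\,d\mu\right\}.$$ A solution is $u\in D(J)$ satisfying the equation at every vertex; a ground state solution is a nontrivial solution $u$ with $J(u)=\inf_{\mathcal{N}}J$. *)

theory Defs
  imports "HOL-Analysis.Analysis"
begin

text \<open>The lattice \<open>\<int>\<^sup>N\<close> is the type \<^typ>\<open>int ^ 'n\<close>, with \<open>N = CARD('n)\<close>.\<close>

definition adj :: "int ^ 'n \<Rightarrow> int ^ 'n \<Rightarrow> bool" (infix \<open>\<sim>\<close> 50)
  where "x \<sim> y \<longleftrightarrow> (\<Sum>i\<in>UNIV. \<bar>x $ i - y $ i\<bar>) = 1"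

text \<open>Local finiteness: the sums over neighbours below range over finite sets.\<close>

lemma finite_neighbours:
  fixes x :: "int ^ 'n"
  shows "finite {y. x \<sim> y}"
proof -
  have "\<bar>x $ i - y $ i\<bar> \<le> 1" if "x \<sim> y" for y i
    using that member_le_sum[of i UNIV "\<lambda>i. \<bar>x $ i - y $ i\<bar>"] by (simp add: adj_def)
  then have "vec_nth y \<in> (\<Pi>\<^sub>E i\<in>UNIV. {x $ i - 1 .. x $ i + 1})" if "x \<sim> y" for y
    using that by (simp add: PiE_iff abs_le_iff algebra_simps)
  then have "{y. x \<sim> y} \<subseteq> vec_lambda ` (\<Pi>\<^sub>E i\<in>UNIV. {x $ i - 1 .. x $ i + 1})"
    by (force intro: image_eqI[where x = "vec_nth _"])
  then show ?thesis
    by (rule finite_subset) (intro finite_imageI finite_PiE; simp)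
qed

definition periodic :: "nat \<Rightarrow> (int ^ 'n \<Rightarrow> real) \<Rightarrow> bool"
  where "periodic T g \<longleftrightarrow> (\<forall>x i. g (x + int T *s axis i 1) = g x)"

definition laplacian :: "(int ^ 'n \<Rightarrow> real) \<Rightarrow> int ^ 'n \<Rightarrow> real"
  where "laplacian u x = (\<Sum>y | x \<sim> y. u y - u x)"

definition grad_sq :: "(int ^ 'n \<Rightarrow> real) \<Rightarrow> int ^ 'n \<Rightarrow> real"
  where "grad_sq u x = 1 / 2 * (\<Sum>y | x \<sim> y. (u y - u x)\<^sup>2)"

text \<open>The integral with values in the extended reals, as the difference of the integrals of the
  positive and the negative part (\<^const>\<open>ennreal\<close> truncates negative numbers to 0). It is
  only meaningful when at least one of the two is finite. The Bochner integral would not do for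
  the energy, being 0 when the integral diverges to infinity.\<close>

definition ext_integral :: "(int ^ 'n \<Rightarrow> real) \<Rightarrow> ereal"
  where "ext_integral f =
    enn2ereal (\<integral>\<^sup>+ x. ennreal (f x) \<partial>count_space UNIV) -
    enn2ereal (\<integral>\<^sup>+ x. ennreal (- f x) \<partial>count_space UNIV)"

definition H1_density :: "(int ^ 'n \<Rightarrow> real) \<Rightarrow> int ^ 'n \<Rightarrow> real"
  where "H1_density u x = grad_sq u x + (u x)\<^sup>2"

definition H1_norm :: "(int ^ 'n \<Rightarrow> real) \<Rightarrow> real"
  where "H1_norm u = sqrt (\<integral>x. H1_density u x \<partial>count_space UNIV)"

text \<open>The completion of the finitely supported functions is realised as a space of functions,
  namely their closure among the functions of finite norm. This is legitimate because the norm
  dominates every point evaluation, so that a Cauchy sequence has a pointwise limit, to which it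
  also converges in norm.\<close>

definition H1 :: "(int ^ 'n \<Rightarrow> real) set"
  where "H1 = {u. integrable (count_space UNIV) (H1_density u) \<and>
    (\<exists>\<phi>. (\<forall>k. finite {x. \<phi> k x \<noteq> 0}) \<and>
      (\<lambda>k::nat. H1_norm (\<lambda>x. u x - \<phi> k x)) \<longlonglongrightarrow> 0)}"

definition X_space :: "(int ^ 'n \<Rightarrow> real) \<Rightarrow> (int ^ 'n \<Rightarrow> real) set"
  where "X_space V = {u \<in> H1. ext_integral (\<lambda>x. (V x + 1) * (u x)\<^sup>2) < \<infinity>}"

text \<open>The convention \<open>0 log 0 = 0\<close> holds automatically, both for \<open>u\<^sup>2 log u\<^sup>2\<close> and for
  \<open>u log u\<^sup>2\<close>. The energy is only used on \<open>X_space V\<close>: there the first integral and that of the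
  positive part of \<open>u\<^sup>2 log u\<^sup>2\<close> are finite, so the energy is never \<open>-\<infinity>\<close>.\<close>

definition energy :: "(int ^ 'n \<Rightarrow> real) \<Rightarrow> (int ^ 'n \<Rightarrow> real) \<Rightarrow> ereal"
  where "energy V u =
    ereal (1 / 2) * ext_integral (\<lambda>x. grad_sq u x + (V x + 1) * (u x)\<^sup>2) -
    ereal (1 / 2) * ext_integral (\<lambda>x. (u x)\<^sup>2 * ln ((u x)\<^sup>2))"

definition energy_domain :: "(int ^ 'n \<Rightarrow> real) \<Rightarrow> (int ^ 'n \<Rightarrow> real) set"
  where "energy_domain V = {u \<in> X_space V. energy V u < \<infinity>}"

definition nehari :: "(int ^ 'n \<Rightarrow> real) \<Rightarrow> (int ^ 'n \<Rightarrow> real) set"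
  where "nehari V = {u \<in> energy_domain V - {\<lambda>x. 0}.
    ext_integral (\<lambda>x. grad_sq u x + V x * (u x)\<^sup>2) =
    ext_integral (\<lambda>x. (u x)\<^sup>2 * ln ((u x)\<^sup>2))}"

definition is_solution :: "(int ^ 'n \<Rightarrow> real) \<Rightarrow> (int ^ 'n \<Rightarrow> real) \<Rightarrow> bool"
  where "is_solution V u \<longleftrightarrow> u \<in> energy_domain V \<and>
    (\<forall>x. - laplacian u x + V x * u x = u x * ln ((u x)\<^sup>2))"

definition ground_state :: "(int ^ 'n \<Rightarrow> real) \<Rightarrow> (int ^ 'n \<Rightarrow> real) \<Rightarrow> bool"
  where "ground_state V u \<longleftrightarrow> is_solution V u \<and> u \<noteq> (\<lambda>x. 0) \<and>
    energy V u = (INF v\<in>nehari V. energy V v)"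

end

theory Submission
  imports Defs
begin

text \<open>Twice the energy is the real number
  \<open>action V u = \<Sum>x. |\<nabla>u|\<^sup>2 + (V + 1) u\<^sup>2 - u\<^sup>2 ln u\<^sup>2\<close>, and the Nehari constraint says that it equals
  \<open>mass u = \<Sum>x. u\<^sup>2\<close>. The logarithm makes the functional almost homogeneous:
  \<open>action V (a u) = a\<^sup>2 action V u - a\<^sup>2 ln a\<^sup>2 mass u\<close>. Hence every ray through a nonzero admissible function
  meets the Nehari manifold at exactly one point, and minimising the energy there amounts to
  minimising the action on the unit sphere of \<open>\<ell>\<^sup>2\<close>. If \<open>w\<close> is a minimiser with value
  \<open>\<lambda> = min_action V\<close>, then \<open>exp ((\<lambda> - 1) / 2) w\<close> is a ground state: the scaling turns the Lagrange
  multiplier of the constraint \<open>mass w = 1\<close> into the logarithm in the equation.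

  On the sphere \<open>|w| \<le> 1\<close>, so each of the three parts of the action density is nonnegative. This makes
  the action bounded below and, by Fatou's lemma, lower semicontinuous under pointwise convergence.
  A minimising sequence has a pointwise convergent subsequence by Tychonoff's theorem, and two losses of mass have to be
  excluded.

  Vanishing: if \<open>w\<^sup>2 \<le> \<delta>\<close> everywhere, then the action is at least \<open>- ln \<delta>\<close>. So each member of the
  sequence has a value bounded away from 0 somewhere (\<open>concentration\<close>), and the periodicity of \<open>V\<close>
  makes it possible to translate this place into a fixed finite box.

  Splitting: cut \<open>w\<close> along a finite set \<open>B\<close> into its restrictions to \<open>B\<close> and \<open>- B\<close>, with masses \<open>p\<close> and \<open>1 - p\<close>.
  The potential and the logarithmic part of the action are additive for functions of disjoint support,
  and the gradient part is so up to the products \<open>w x * w y\<close> over the edges that leave \<open>B\<close>. The lower bound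
  \<open>action V u \<ge> \<lambda> mass u - mass u ln (mass u)\<close> for both pieces then shows that the entropy
  \<open>- p ln p - (1 - p) ln (1 - p)\<close> is at most \<open>action V w - \<lambda>\<close> plus a boundary sum
  (\<open>entropy_of_cut_le\<close>). For fixed \<open>B\<close> only finitely many values of \<open>w\<close> enter \<open>p\<close> and the boundary
  sum, so the inequality passes to the pointwise limit; letting \<open>B\<close> exhaust the lattice makes the
  boundary sum vanish. The limit, of mass \<open>m \<in> (0, 1]\<close>, thus has entropy 0, whence \<open>m = 1\<close>.

  Taking absolute values does not increase the action, which gives a nonnegative minimiser. It is positive
  because a zero of a nonnegative solution forces the sum over its neighbours to vanish, and the lattice
  is connected.\<close>

section \<open>Lattice and translations\<close>

text \<open>Neighbours are reached from \<open>x\<close> by steps that do not depend on \<open>x\<close>; sums over neighbours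
  written with these steps are visibly translation invariant.\<close>

definition unit_steps :: "(int ^ 'n) set"
  where "unit_steps = {e. 0 \<sim> e}"

lemma finite_unit_steps: "finite unit_steps"
  by (simp add: unit_steps_def finite_neighbours)

lemma adj_iff_unit_step: "x \<sim> y \<longleftrightarrow> y - x \<in> unit_steps"
  by (simp add: unit_steps_def adj_def abs_minus_commute)

lemma neighbours_eq_image: "{y. x \<sim> y} = (+) x ` unit_steps"
  by (force simp: adj_iff_unit_step image_iff algebra_simps)

lemma sum_neighbours: "(\<Sum>y | x \<sim> y. f y) = (\<Sum>e\<in>unit_steps. f (x + e))"
  unfolding neighbours_eq_image by (subst sum.reindex) (auto simp: inj_on_def)

lemma axis_unit_step: "axis i 1 \<in> unit_steps"
  unfolding unit_steps_def adj_def axis_def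
  by (simp add: if_distrib cong: if_cong)

lemma uminus_unit_step: "- e \<in> unit_steps \<longleftrightarrow> e \<in> unit_steps"
  by (simp add: unit_steps_def adj_def)

text \<open>The lattice is connected. A coordinate different from 0 can be moved towards 0, which lowers
  the \<open>\<ell>\<^sup>1\<close> distance to the origin.\<close>

lemma lattice_induct:
  fixes x :: "int ^ 'n"
  assumes "P 0"
    and "\<And>x i. P x \<Longrightarrow> P (x + axis i 1)"
    and "\<And>x i. P x \<Longrightarrow> P (x - axis i 1)"
  shows "P x"
proof (induction "nat (\<Sum>i\<in>UNIV. \<bar>x $ i\<bar>)" arbitrary: x rule: less_induct)
  case less
  show ?case
  proof (cases "x = 0")
    case False
    then obtain i where i: "x $ i \<noteq> 0"
      by (auto simp: vec_eq_iff)
    define y where "y = (if x $ i > 0 then x - axis i 1 else x + axis i 1)"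
    have yi: "\<bar>y $ i\<bar> < \<bar>x $ i\<bar>" using i by (auto simp: y_def)
    have "\<bar>y $ j\<bar> \<le> \<bar>x $ j\<bar>" for j
      using yi by (cases "j = i") (auto simp: y_def axis_def)
    then have "(\<Sum>j\<in>UNIV. \<bar>y $ j\<bar>) < (\<Sum>j\<in>UNIV. \<bar>x $ j\<bar>)"
      using yi by (intro sum_strict_mono_ex1) auto
    moreover have "0 \<le> (\<Sum>j\<in>UNIV. \<bar>y $ j\<bar>)" by (simp add: sum_nonneg)
    ultimately have "P y" by (intro less) linarith
    then show ?thesis
      using assms(2)[of y i] assms(3)[of y i] by (auto simp: y_def split: if_splits)
  qed (simp add: assms)
qed

text \<open>The periods of \<open>V\<close> form a group, and this group contains \<open>T\<close> times each unit vector.\<close>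

lemma periodic_shift:
  assumes "periodic T V"
  shows "V (x + int T *s q) = V x"
proof -
  have "\<forall>x. V (x + int T *s q) = V x"
  proof (induction q rule: lattice_induct)
    case (2 q i)
    have "V (x + int T *s (q + axis i 1)) = V x" for x
      using 2 assms unfolding periodic_def
      by (metis add.assoc vector_add_ldistrib)
    then show ?case by blast
  next
    case (3 q i)
    have "V (x + int T *s (q - axis i 1)) = V x" for x
    proof -
      have "x + int T *s (q - axis i 1) + int T *s axis i 1 = x + int T *s q"
        by (simp add: vec_eq_iff algebra_simps)
      then show ?thesis using 3 assms unfolding periodic_def by metis
    qed
    then show ?case by blast
  qed simp
  then show ?thesis by blast
qed

section \<open>Compactness and sums\<close>

text \<open>A countable product of compact intervals is compact by Tychonoff's theorem, and it is first
  countable, so that compactness yields subsequences.\<close>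

lemma pointwise_convergent_subsequence:
  fixes w :: "nat \<Rightarrow> 'a::countable \<Rightarrow> real"
  assumes "\<And>k x. \<bar>w k x\<bar> \<le> 1"
  obtains r l where "strict_mono (r :: nat \<Rightarrow> nat)" "\<And>x. (\<lambda>k. w (r k) x) \<longlonglongrightarrow> l x"
proof -
  have "compactin (product_topology (\<lambda>x::'a. euclidean) UNIV) (\<Pi>\<^sub>E x\<in>UNIV. {-1..1::real})"
    by (subst compactin_PiE) auto
  then have "compact (\<Pi>\<^sub>E x\<in>(UNIV::'a set). {-1..1::real})"
    by (simp add: euclidean_product_topology)
  then have "seq_compact (\<Pi>\<^sub>E x\<in>(UNIV::'a set). {-1..1::real})"
    by (rule compact_imp_seq_compact)
  moreover have "w k \<in> (\<Pi>\<^sub>E x\<in>(UNIV::'a set). {-1..1::real})" for k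
    using assms by (auto simp: PiE_iff abs_le_iff minus_le_iff)
  ultimately obtain l r where r: "strict_mono (r :: nat \<Rightarrow> nat)" "(w \<circ> r) \<longlonglongrightarrow> l"
    unfolding seq_compact_def by metis
  have "(\<lambda>k. w (r k) x) \<longlonglongrightarrow> l x" for x
  proof -
    have "isCont (\<lambda>f::'a\<Rightarrow>real. f x) l"
      using continuous_on_product_coordinates[of x] continuous_on_eq_continuous_at[OF open_UNIV]
      by blast
    from isCont_tendsto_compose[OF this r(2)] show ?thesis by (simp add: o_def)
  qed
  then show thesis using r that by blast
qed

lemma integrable_count_space_iff_summable_on:
  fixes f :: "'a \<Rightarrow> real"
  shows "integrable (count_space UNIV) f \<longleftrightarrow> f summable_on UNIV"
  using abs_summable_equivalent[of f UNIV] summable_on_iff_abs_summable_on_real[of f UNIV]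
  by (simp add: abs_summable_on_def)

lemma integral_count_space_eq_infsum:
  fixes f :: "'a \<Rightarrow> real"
  assumes "f summable_on UNIV"
  shows "(\<integral>x. f x \<partial>count_space UNIV) = infsum f UNIV"
  using infsetsum_infsum[of f UNIV] abs_summable_equivalent[of f UNIV]
    summable_on_iff_abs_summable_on_real[of f UNIV] assms
  by (simp add: infsetsum_def)

lemma nn_integral_count_space_eq_infsum:
  fixes f :: "'a \<Rightarrow> real"
  assumes "\<And>x. f x \<ge> 0" "f summable_on UNIV"
  shows "(\<integral>\<^sup>+ x. ennreal (f x) \<partial>count_space UNIV) = ennreal (infsum f UNIV)"
  using assms
  by (simp add: nn_integral_eq_integral integrable_count_space_iff_summable_on
      integral_count_space_eq_infsum)

lemma nn_integral_finite_imp_summable: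
  fixes f :: "'a \<Rightarrow> real"
  assumes "\<And>x. f x \<ge> 0" "(\<integral>\<^sup>+ x. ennreal (f x) \<partial>count_space UNIV) < \<infinity>"
  shows "f summable_on UNIV"
proof -
  have "integrable (count_space UNIV) f"
    using assms by (intro integrableI_nonneg) auto
  then show ?thesis by (simp add: integrable_count_space_iff_summable_on)
qed

text \<open>With this, the extended integrals in the energy become unordered sums of real numbers, which
  the rest of the argument works with.\<close>

lemma ext_integral_eq_infsum:
  fixes f :: "int ^ 'n \<Rightarrow> real"
  assumes "f summable_on UNIV"
  shows "ext_integral f = ereal (infsum f UNIV)"
proof -
  have abs: "(\<lambda>x. \<bar>f x\<bar>) summable_on UNIV"
    using assms summable_on_iff_abs_summable_on_real[of f UNIV] by simp
  have pos: "(\<lambda>x. max 0 (f x)) summable_on UNIV"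
    by (rule summable_on_comparison_test[OF abs]) auto
  have neg: "(\<lambda>x. max 0 (- f x)) summable_on UNIV"
    by (rule summable_on_comparison_test[OF abs]) auto
  have trunc: "ennreal (max 0 r) = ennreal r" for r :: real
    by (simp add: max_def ennreal_neg)
  have "(\<integral>\<^sup>+ x. ennreal (f x) \<partial>count_space UNIV) = ennreal (\<Sum>\<^sub>\<infinity>x. max 0 (f x))"
    using nn_integral_count_space_eq_infsum[OF _ pos] by (simp add: trunc)
  moreover have "(\<integral>\<^sup>+ x. ennreal (- f x) \<partial>count_space UNIV) = ennreal (\<Sum>\<^sub>\<infinity>x. max 0 (- f x))"
    using nn_integral_count_space_eq_infsum[OF _ neg] by (simp add: trunc)
  moreover have "(\<Sum>\<^sub>\<infinity>x. max 0 (f x)) - (\<Sum>\<^sub>\<infinity>x. max 0 (- f x)) = infsum f UNIV"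
  proof -
    have "infsum f UNIV = (\<Sum>\<^sub>\<infinity>x. max 0 (f x) + - max 0 (- f x))"
      by (intro infsum_cong) auto
    also have "\<dots> = (\<Sum>\<^sub>\<infinity>x. max 0 (f x)) + (\<Sum>\<^sub>\<infinity>x. - max 0 (- f x))"
      using pos neg by (intro infsum_add) (simp_all add: summable_on_uminus)
    finally show ?thesis by (simp add: infsum_uminus)
  qed
  ultimately show ?thesis
    by (simp add: ext_integral_def infsum_nonneg enn2ereal_ennreal)
qed

section \<open>The logarithmic nonlinearity\<close>

text \<open>The bound \<open>t ln t = O(sqrt t)\<close> comes from \<open>ln s \<le> s - 1\<close> at \<open>s = 1 / sqrt t\<close>. The limit is
  two-sided because \<^const>\<open>ln\<close> is an even function on the nonzero reals.\<close>

lemma tendsto_mult_ln_zero: "((\<lambda>t::real. t * ln t) \<longlongrightarrow> 0) (at 0)"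
proof (rule Lim_null_comparison)
  have bound: "\<bar>t * ln t\<bar> \<le> 2 * sqrt \<bar>t\<bar>" if t: "t > 0" "t < 1" for t :: real
  proof -
    have "- ln (sqrt t) = ln (1 / sqrt t)" using t by (simp add: ln_div)
    also have "\<dots> \<le> 1 / sqrt t" using t ln_le_minus_one[of "1 / sqrt t"] by simp
    finally have "t * - ln (sqrt t) \<le> t * (1 / sqrt t)" using t by (intro mult_left_mono) auto
    also have "t * (1 / sqrt t) = sqrt t" using t by (simp add: real_div_sqrt)
    finally show ?thesis using t by (simp add: ln_sqrt abs_mult)
  qed
  show "\<forall>\<^sub>F t in at (0::real). norm (t * ln t) \<le> 2 * sqrt \<bar>t\<bar>"
    unfolding eventually_at
  proof (intro exI[of _ 1] conjI ballI impI)
    fix t :: real assume "t \<noteq> 0 \<and> dist t 0 < 1"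
    then show "norm (t * ln t) \<le> 2 * sqrt \<bar>t\<bar>"
      using bound[of t] bound[of "- t"] by (cases "t > 0") (auto simp: ln_minus)
  qed simp
  have "((\<lambda>t::real. 2 * sqrt \<bar>t\<bar>) \<longlongrightarrow> 2 * sqrt \<bar>0\<bar>) (at 0)"
    by (intro tendsto_intros)
  then show "((\<lambda>t::real. 2 * sqrt \<bar>t\<bar>) \<longlongrightarrow> 0) (at 0)" by simp
qed

lemma isCont_mult_ln: "isCont (\<lambda>t::real. t * ln t) t"
proof (cases "t = 0")
  case True
  then show ?thesis using tendsto_mult_ln_zero by (simp add: isCont_def)
next
  case False
  then show ?thesis by (intro continuous_intros) auto
qed

definition sq_log :: "real \<Rightarrow> real"
  where "sq_log s = s\<^sup>2 * ln (s\<^sup>2)"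

lemma sq_log_0 [simp]: "sq_log 0 = 0"
  by (simp add: sq_log_def)

lemma isCont_sq_log: "isCont sq_log s"
proof -
  have "isCont (\<lambda>s. (\<lambda>t. t * ln t) (s\<^sup>2)) s"
    by (rule isCont_o2[OF _ isCont_mult_ln]) simp
  then show ?thesis by (simp add: sq_log_def[abs_def])
qed

text \<open>The formula includes \<open>s = 0\<close>: there the difference quotient is \<open>2 h ln h\<close>, which tends to 0.
  Thus the action can be differentiated also at points where the function vanishes.\<close>

lemma DERIV_sq_log: "(sq_log has_real_derivative 2 * s * ln (s\<^sup>2) + 2 * s) (at s)"
proof (cases "s = 0")
  case True
  have "((\<lambda>h::real. 2 * (h * ln h)) \<longlongrightarrow> 2 * 0) (at 0)"
    by (intro tendsto_intros tendsto_mult_ln_zero)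
  moreover have "(sq_log (0 + h) - sq_log 0) / h = 2 * (h * ln h)" for h :: real
    by (simp add: sq_log_def power2_eq_square ln_mult)
  ultimately have "DERIV sq_log 0 :> 0"
    unfolding DERIV_def by simp
  then show ?thesis using True by simp
next
  case False
  have "((\<lambda>s. s\<^sup>2 * ln (s\<^sup>2)) has_real_derivative 2 * s * ln (s\<^sup>2) + inverse (s\<^sup>2) * (2 * s) * s\<^sup>2) (at s)"
    using False by (auto intro!: derivative_eq_intros)
  moreover have "inverse (s\<^sup>2) * (2 * s) * s\<^sup>2 = 2 * s" using False by simp
  ultimately show ?thesis by (simp add: sq_log_def[abs_def])
qed

lemma sq_log_nonpos:
  assumes "\<bar>s\<bar> \<le> 1"
  shows "sq_log s \<le> 0"
proof (cases "s = 0")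
  case False
  have "ln (s\<^sup>2) \<le> 0" using False assms by (simp add: abs_square_le_1)
  then show ?thesis by (simp add: sq_log_def mult_nonneg_nonpos)
qed simp

lemma sq_log_scale:
  assumes "a \<noteq> 0"
  shows "sq_log (a * s) = a\<^sup>2 * sq_log s + a\<^sup>2 * ln (a\<^sup>2) * s\<^sup>2"
  using assms by (cases "s = 0") (simp_all add: sq_log_def power_mult_distrib ln_mult algebra_simps)

section \<open>The action\<close>

definition mass :: "(int ^ 'n \<Rightarrow> real) \<Rightarrow> real"
  where "mass u = (\<Sum>\<^sub>\<infinity>x. (u x)\<^sup>2)"

text \<open>For \<open>V \<ge> - 1\<close> these are the functions of finite energy (see \<open>energy_domain_iff_admissible\<close>). The
  three parts are required to be summable one by one, which makes the class visibly stable under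
  restriction to a set.\<close>

definition admissible :: "(int ^ 'n \<Rightarrow> real) \<Rightarrow> (int ^ 'n \<Rightarrow> real) \<Rightarrow> bool"
  where "admissible V u \<longleftrightarrow> (\<lambda>x. (u x)\<^sup>2) summable_on UNIV \<and>
    (\<lambda>x. (V x + 1) * (u x)\<^sup>2) summable_on UNIV \<and> (\<lambda>x. sq_log (u x)) summable_on UNIV"

definition action_density :: "(int ^ 'n \<Rightarrow> real) \<Rightarrow> (int ^ 'n \<Rightarrow> real) \<Rightarrow> int ^ 'n \<Rightarrow> real"
  where "action_density V u x = grad_sq u x + (V x + 1) * (u x)\<^sup>2 - sq_log (u x)"

text \<open>Twice the energy, as a real number.\<close>

definition action :: "(int ^ 'n \<Rightarrow> real) \<Rightarrow> (int ^ 'n \<Rightarrow> real) \<Rightarrow> real"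
  where "action V u = (\<Sum>\<^sub>\<infinity>x. action_density V u x)"

lemma bij_lattice_shift: "bij (\<lambda>x :: int ^ 'n. x + e)"
  by (rule bijI') (auto intro: exI[of _ "_ - e"])

lemma summable_on_lattice_shift:
  fixes f :: "int ^ 'n \<Rightarrow> real"
  shows "(\<lambda>x. f (x + e)) summable_on UNIV \<longleftrightarrow> f summable_on UNIV"
  by (rule summable_on_reindex_bij_betw[OF bij_lattice_shift])

lemma infsum_lattice_shift:
  fixes f :: "int ^ 'n \<Rightarrow> real"
  shows "(\<Sum>\<^sub>\<infinity>x. f (x + e)) = infsum f UNIV"
  by (rule infsum_reindex_bij_betw[OF bij_lattice_shift])

lemma summable_on_finite_sum:
  fixes f :: "'i \<Rightarrow> 'a \<Rightarrow> real"
  assumes "finite I" "\<And>i. i \<in> I \<Longrightarrow> f i summable_on A"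
  shows "(\<lambda>x. \<Sum>i\<in>I. f i x) summable_on A"
  using assms by (induction I rule: finite_induct) (auto intro: summable_on_add)

lemma infsum_finite_sum:
  fixes f :: "'i \<Rightarrow> 'a \<Rightarrow> real"
  assumes "finite I" "\<And>i. i \<in> I \<Longrightarrow> f i summable_on A"
  shows "(\<Sum>\<^sub>\<infinity>x\<in>A. \<Sum>i\<in>I. f i x) = (\<Sum>i\<in>I. infsum (f i) A)"
  using assms
  by (induction I rule: finite_induct) (auto simp: infsum_add summable_on_finite_sum)

lemma grad_sq_nonneg: "grad_sq u x \<ge> 0"
  by (simp add: grad_sq_def sum_nonneg)

lemma grad_sq_eq: "grad_sq u x = 1 / 2 * (\<Sum>e\<in>unit_steps. (u (x + e) - u x)\<^sup>2)"
  by (simp add: grad_sq_def sum_neighbours)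

lemma grad_sq_le: "grad_sq u x \<le> (\<Sum>e\<in>unit_steps. (u (x + e))\<^sup>2 + (u x)\<^sup>2)"
proof -
  have "(a - b)\<^sup>2 \<le> 2 * (a\<^sup>2 + b\<^sup>2)" for a b :: real
    using sum_squares_ge_zero[of "a + b" 0] by (simp add: power2_eq_square algebra_simps)
  then have "(\<Sum>e\<in>unit_steps. (u (x + e) - u x)\<^sup>2) \<le> (\<Sum>e\<in>unit_steps. 2 * ((u (x + e))\<^sup>2 + (u x)\<^sup>2))"
    by (intro sum_mono)
  also have "\<dots> = 2 * (\<Sum>e\<in>unit_steps. (u (x + e))\<^sup>2 + (u x)\<^sup>2)"
    by (simp only: sum_distrib_left)
  finally show ?thesis by (simp add: grad_sq_eq)
qed

lemma
  assumes u: "(\<lambda>x. (u x)\<^sup>2) summable_on UNIV"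
  shows summable_grad_sq: "grad_sq u summable_on UNIV"
    and infsum_grad_sq_le: "infsum (grad_sq u) UNIV
      \<le> 2 * real (card (unit_steps :: (int ^ 'n) set)) * mass (u :: int ^ 'n \<Rightarrow> real)"
proof -
  have s: "(\<lambda>x. (u (x + e))\<^sup>2) summable_on UNIV" for e
    using u summable_on_lattice_shift[of "\<lambda>x. (u x)\<^sup>2" e] by simp
  have t: "(\<lambda>x. (u (x + e))\<^sup>2 + (u x)\<^sup>2) summable_on UNIV" for e
    by (intro summable_on_add s u)
  have tt: "(\<lambda>x. \<Sum>e\<in>unit_steps. (u (x + e))\<^sup>2 + (u x)\<^sup>2) summable_on UNIV"
    by (intro summable_on_finite_sum finite_unit_steps t)
  show g: "grad_sq u summable_on UNIV"
    by (rule summable_on_comparison_test[OF tt]) (auto simp: grad_sq_le grad_sq_nonneg)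
  have "infsum (grad_sq u) UNIV \<le> (\<Sum>\<^sub>\<infinity>x. \<Sum>e\<in>unit_steps. (u (x + e))\<^sup>2 + (u x)\<^sup>2)"
    by (intro infsum_mono g tt grad_sq_le)
  also have "\<dots> = (\<Sum>e\<in>unit_steps. \<Sum>\<^sub>\<infinity>x. (u (x + e))\<^sup>2 + (u x)\<^sup>2)"
    by (intro infsum_finite_sum finite_unit_steps t)
  also have "\<dots> = (\<Sum>e\<in>(unit_steps :: (int ^ 'n) set). 2 * mass u)"
    by (intro sum.cong refl) (simp add: infsum_add s u mass_def infsum_lattice_shift[of "\<lambda>x. (u x)\<^sup>2"])
  finally show "infsum (grad_sq u) UNIV
      \<le> 2 * real (card (unit_steps :: (int ^ 'n) set)) * mass u"
    by simp
qed

lemma summable_action_density: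
  assumes "admissible V u"
  shows "action_density V u summable_on UNIV"
proof -
  have "(\<lambda>x. grad_sq u x + (V x + 1) * (u x)\<^sup>2 + - sq_log (u x)) summable_on UNIV"
    using assms unfolding admissible_def
    by (intro summable_on_add summable_grad_sq) (auto simp: summable_on_uminus)
  then show ?thesis by (simp add: action_density_def[abs_def])
qed

lemma action_eq:
  assumes "admissible V u"
  shows "action V u = (\<Sum>\<^sub>\<infinity>x. grad_sq u x + (V x + 1) * (u x)\<^sup>2) - (\<Sum>\<^sub>\<infinity>x. sq_log (u x))"
proof -
  have "(\<Sum>\<^sub>\<infinity>x. (grad_sq u x + (V x + 1) * (u x)\<^sup>2) + - sq_log (u x)) =
      (\<Sum>\<^sub>\<infinity>x. grad_sq u x + (V x + 1) * (u x)\<^sup>2) + (\<Sum>\<^sub>\<infinity>x. - sq_log (u x))"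
    using assms unfolding admissible_def
    by (intro infsum_add summable_on_add summable_grad_sq) (auto simp: summable_on_uminus)
  then show ?thesis
    by (simp add: action_def action_density_def[abs_def] infsum_uminus)
qed

lemma mass_nonneg: "mass u \<ge> 0"
  unfolding mass_def by (intro infsum_nonneg) auto

lemma mass_eq_0_iff:
  assumes "(\<lambda>x. (u x)\<^sup>2) summable_on UNIV"
  shows "mass u = 0 \<longleftrightarrow> u = (\<lambda>x. 0)"
proof
  assume "mass u = 0"
  then have "(u x)\<^sup>2 = 0" for x
    using nonneg_infsum_le_0D[OF _ assms, of x] by (simp add: mass_def)
  then show "u = (\<lambda>x. 0)" by auto
qed (simp add: mass_def)

lemma square_le_mass:
  assumes "(\<lambda>x. (u x)\<^sup>2) summable_on UNIV"
  shows "(u x)\<^sup>2 \<le> mass u"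
  using finite_sum_le_infsum[OF assms, of "{x}"] by (simp add: mass_def)

lemma grad_sq_scale: "grad_sq (\<lambda>x. a * u x) x = a\<^sup>2 * grad_sq u x"
proof -
  have "(a * u y - a * u x)\<^sup>2 = a\<^sup>2 * (u y - u x)\<^sup>2" for y
    by (simp add: power2_eq_square algebra_simps)
  then show ?thesis by (simp add: grad_sq_def flip: sum_distrib_left)
qed

lemma mass_scale: "mass (\<lambda>x. a * u x) = a\<^sup>2 * mass u"
  by (simp add: mass_def power_mult_distrib infsum_cmult_right')

lemma admissible_scale:
  assumes "admissible V u" "a \<noteq> 0"
  shows "admissible V (\<lambda>x. a * u x)"
proof -
  have "(\<lambda>x. a\<^sup>2 * ((V x + 1) * (u x)\<^sup>2)) summable_on UNIV"
    using assms unfolding admissible_def by (intro summable_on_cmult_right) auto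
  moreover have "(\<lambda>x. a\<^sup>2 * (u x)\<^sup>2) summable_on UNIV"
    using assms unfolding admissible_def by (intro summable_on_cmult_right) auto
  moreover have "(\<lambda>x. a\<^sup>2 * sq_log (u x) + a\<^sup>2 * ln (a\<^sup>2) * (u x)\<^sup>2) summable_on UNIV"
    using assms unfolding admissible_def by (intro summable_on_add summable_on_cmult_right) auto
  ultimately show ?thesis
    using assms(2) by (simp add: admissible_def power_mult_distrib sq_log_scale mult.left_commute)
qed

text \<open>The action is homogeneous of degree 2 but for the term that the logarithm produces.\<close>

lemma action_scale:
  assumes "admissible V u" "a \<noteq> 0"
  shows "action V (\<lambda>x. a * u x) = a\<^sup>2 * action V u - a\<^sup>2 * ln (a\<^sup>2) * mass u"
proof -
  have "action_density V (\<lambda>x. a * u x) x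
      = a\<^sup>2 * action_density V u x + (- (a\<^sup>2 * ln (a\<^sup>2))) * (u x)\<^sup>2" for x
    using assms(2)
    by (simp add: action_density_def grad_sq_scale power_mult_distrib sq_log_scale algebra_simps)
  then have "action V (\<lambda>x. a * u x)
      = (\<Sum>\<^sub>\<infinity>x. a\<^sup>2 * action_density V u x + (- (a\<^sup>2 * ln (a\<^sup>2))) * (u x)\<^sup>2)"
    by (simp add: action_def)
  also have "\<dots> = (\<Sum>\<^sub>\<infinity>x. a\<^sup>2 * action_density V u x) + (\<Sum>\<^sub>\<infinity>x. (- (a\<^sup>2 * ln (a\<^sup>2))) * (u x)\<^sup>2)"
    using assms summable_action_density[OF assms(1)] unfolding admissible_def
    by (intro infsum_add summable_on_cmult_right) auto
  also have "\<dots> = a\<^sup>2 * action V u - a\<^sup>2 * ln (a\<^sup>2) * mass u"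
    by (simp only: infsum_cmult_right' action_def mass_def) simp
  finally show ?thesis .
qed

lemma action_density_nonneg:
  assumes "\<And>x. V x \<ge> - 1" "\<bar>u x\<bar> \<le> 1"
  shows "action_density V u x \<ge> 0"
proof -
  have "(V x + 1) * (u x)\<^sup>2 \<ge> 0" using assms(1)[of x] by simp
  then show ?thesis
    using sq_log_nonpos[OF assms(2)] grad_sq_nonneg[of u x] unfolding action_density_def by linarith
qed

text \<open>For \<open>|u| \<le> 1\<close> the three parts of the density are nonnegative, so each of them is dominated by the
  whole.\<close>

lemma admissible_if_density_summable:
  assumes V: "\<And>x. V x \<ge> - 1" and u1: "\<And>x. \<bar>u x\<bar> \<le> 1"
    and u: "(\<lambda>x. (u x)\<^sup>2) summable_on UNIV" and d: "action_density V u summable_on UNIV"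
  shows "admissible V u"
proof -
  have n: "grad_sq u x \<ge> 0" "(V x + 1) * (u x)\<^sup>2 \<ge> 0" "- sq_log (u x) \<ge> 0" for x
    using V[of x] sq_log_nonpos[OF u1, of x] grad_sq_nonneg[of u x] by simp_all
  have le: "(V x + 1) * (u x)\<^sup>2 \<le> action_density V u x" "- sq_log (u x) \<le> action_density V u x" for x
    using n[of x] unfolding action_density_def by linarith+
  have "(\<lambda>x. (V x + 1) * (u x)\<^sup>2) summable_on UNIV"
    using summable_on_comparison_test[OF d le(1) n(2)] .
  moreover have "(\<lambda>x. - sq_log (u x)) summable_on UNIV"
    using summable_on_comparison_test[OF d le(2) n(3)] .
  ultimately show ?thesis
    using u summable_on_uminus[of "\<lambda>x. - sq_log (u x)" UNIV] by (simp add: admissible_def)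
qed

lemma admissible_restrict:
  fixes u :: "int ^ 'n \<Rightarrow> real"
  assumes "admissible V u"
  shows "admissible V (\<lambda>x. if x \<in> B then u x else 0)"
proof -
  have "(\<lambda>x. if x \<in> B then f x else 0) summable_on UNIV" if "f summable_on UNIV"
    for f :: "int ^ 'n \<Rightarrow> real"
  proof -
    have "f summable_on B" using that by (rule summable_on_subset) auto
    moreover have "(\<lambda>x. if x \<in> B then f x else 0) summable_on UNIV \<longleftrightarrow> f summable_on B"
      by (rule summable_on_cong_neutral) auto
    ultimately show ?thesis by simp
  qed
  then show ?thesis
    using assms by (simp add: admissible_def if_distrib[of "\<lambda>t. t\<^sup>2"] if_distrib[of sq_log]
        if_distrib[of "\<lambda>t. _ * t"] cong: if_cong)
qed

lemma admissible_finite_support: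
  assumes "finite {x. u x \<noteq> 0}"
  shows "admissible V u"
  unfolding admissible_def
  by (intro conjI finite_nonzero_values_imp_summable_on finite_subset[OF _ assms]) auto

definition unit_sphere :: "(int ^ 'n \<Rightarrow> real) \<Rightarrow> (int ^ 'n \<Rightarrow> real) set"
  where "unit_sphere V = {w. admissible V w \<and> mass w = 1}"

definition min_action :: "(int ^ 'n \<Rightarrow> real) \<Rightarrow> real"
  where "min_action V = (INF w\<in>unit_sphere V. action V w)"

lemma unit_sphere_abs_le_1:
  assumes "w \<in> unit_sphere V"
  shows "\<bar>w x\<bar> \<le> 1"
proof -
  have "(w x)\<^sup>2 \<le> 1"
    using assms square_le_mass[of w x] by (auto simp: unit_sphere_def admissible_def)
  then show ?thesis by (simp add: abs_square_le_1)
qed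

lemma unit_sphere_nonempty:
  fixes V :: "int ^ 'n \<Rightarrow> real"
  shows "unit_sphere V \<noteq> {}"
proof -
  define w :: "int ^ 'n \<Rightarrow> real" where "w = (\<lambda>x. if x = 0 then 1 else 0)"
  have "mass w = (\<Sum>\<^sub>\<infinity>x\<in>{0}. (w x)\<^sup>2)"
    unfolding mass_def by (rule infsum_cong_neutral) (auto simp: w_def)
  then have "mass w = 1" by (simp add: w_def)
  moreover have "admissible V w"
    by (rule admissible_finite_support) (simp add: w_def)
  ultimately show ?thesis by (auto simp: unit_sphere_def)
qed

lemma bdd_below_action:
  assumes "\<And>x. V x \<ge> - 1"
  shows "bdd_below (action V ` unit_sphere V)"
proof (rule bdd_belowI2)
  fix w assume w: "w \<in> unit_sphere V"
  show "0 \<le> action V w"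
    unfolding action_def
    by (intro infsum_nonneg action_density_nonneg unit_sphere_abs_le_1[OF w] assms)
qed

text \<open>Homogeneity: rescale \<open>u\<close> to the unit sphere.\<close>

lemma action_ge:
  assumes V: "\<And>x. V x \<ge> - 1" and u: "admissible V u"
  shows "action V u \<ge> mass u * min_action V - mass u * ln (mass u)"
proof (cases "mass u = 0")
  case True
  then have "u = (\<lambda>x. 0)" using u mass_eq_0_iff by (auto simp: admissible_def)
  then have "action V u = 0"
    by (simp add: action_def action_density_def grad_sq_def)
  then show ?thesis using True by simp
next
  case False
  define m where "m = mass u"
  have m: "m > 0" using False mass_nonneg[of u] by (simp add: m_def)
  \<comment> \<open>The factor that rescales \<open>u\<close> to mass 1.\<close>
  define a where "a = 1 / sqrt m"
  have a: "a \<noteq> 0" "a\<^sup>2 = 1 / m" using m by (auto simp: a_def power_divide)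
  have "(\<lambda>x. a * u x) \<in> unit_sphere V"
    using admissible_scale[OF u a(1)] m by (simp add: unit_sphere_def mass_scale a m_def)
  then have "min_action V \<le> action V (\<lambda>x. a * u x)"
    unfolding min_action_def by (intro cINF_lower bdd_below_action V)
  also have "\<dots> = action V u / m + ln m"
    using action_scale[OF u a(1)] m a by (simp add: m_def[symmetric] ln_div)
  finally have "m * min_action V \<le> m * (action V u / m + ln m)"
    using m by (intro mult_left_mono) auto
  also have "\<dots> = action V u + m * ln m" using m by (simp add: algebra_simps)
  finally show ?thesis by (simp add: m_def)
qed

section \<open>Cutting along a finite set\<close>

text \<open>The products over the edges at \<open>x\<close> that have exactly one endpoint in \<open>B\<close>. These are what the two
  halves of a cut function fail to contribute to the gradient term.\<close>

definition boundary_term :: "(int ^ 'n) set \<Rightarrow> (int ^ 'n \<Rightarrow> real) \<Rightarrow> int ^ 'n \<Rightarrow> real"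
  where "boundary_term B w x =
    (\<Sum>e\<in>unit_steps. if (x \<in> B) \<noteq> (x + e \<in> B) then w x * w (x + e) else 0)"

text \<open>A finite set outside of which no edge meets \<open>B\<close>.\<close>

definition collar :: "(int ^ 'n) set \<Rightarrow> (int ^ 'n) set"
  where "collar B = B \<union> (\<Union>e\<in>unit_steps. (\<lambda>x. x - e) ` B)"

lemma finite_collar: "finite B \<Longrightarrow> finite (collar B)"
  by (simp add: collar_def finite_unit_steps)

lemma boundary_term_outside_collar:
  assumes "x \<notin> collar B"
  shows "boundary_term B w x = 0"
proof -
  have "x \<notin> B" using assms by (simp add: collar_def)
  moreover have "x + e \<notin> B" if "e \<in> unit_steps" for e
    using assms that by (force simp: collar_def image_iff)
  ultimately show ?thesis by (simp add: boundary_term_def)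
qed

text \<open>With \<open>u\<close>, \<open>v\<close> the two halves, \<open>(w' - w)\<^sup>2\<close> on an edge expands into the squares for \<open>u\<close> and \<open>v\<close> and
  twice the product of their differences. As \<open>u v = 0\<close>, that product is \<open>- w w'\<close> on the edges that
  cross the boundary of \<open>B\<close> and 0 on the others.\<close>

lemma action_density_split:
  fixes w :: "int ^ 'n \<Rightarrow> real"
  defines "u \<equiv> \<lambda>B x. if x \<in> B then w x else 0"
  shows "action_density V w x =
    action_density V (u B) x + action_density V (u (- B)) x - boundary_term B w x"
proof -
  have "(w (x + e) - w x)\<^sup>2 / 2 = (u B (x + e) - u B x)\<^sup>2 / 2 + (u (- B) (x + e) - u (- B) x)\<^sup>2 / 2
      - (if (x \<in> B) \<noteq> (x + e \<in> B) then w x * w (x + e) else 0)" for e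
    by (cases "x \<in> B"; cases "x + e \<in> B") (simp_all add: u_def power2_diff add_divide_distrib diff_divide_distrib)
  then have "(\<Sum>e\<in>unit_steps. (w (x + e) - w x)\<^sup>2 / 2) =
      (\<Sum>e\<in>unit_steps. (u B (x + e) - u B x)\<^sup>2 / 2) + (\<Sum>e\<in>unit_steps. (u (- B) (x + e) - u (- B) x)\<^sup>2 / 2)
      - boundary_term B w x"
    by (simp only: sum.distrib sum_subtractf boundary_term_def)
  then have "grad_sq w x = grad_sq (u B) x + grad_sq (u (- B)) x - boundary_term B w x"
    by (simp add: grad_sq_eq sum_divide_distrib)
  moreover have "(w x)\<^sup>2 = (u B x)\<^sup>2 + (u (- B) x)\<^sup>2" "sq_log (w x) = sq_log (u B x) + sq_log (u (- B) x)"
    by (auto simp: u_def)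
  ultimately show ?thesis
    by (simp add: action_density_def algebra_simps)
qed

lemma mass_split:
  fixes w :: "int ^ 'n \<Rightarrow> real"
  assumes "finite B" "(\<lambda>x. (w x)\<^sup>2) summable_on UNIV"
  shows "mass (\<lambda>x. if x \<in> B then w x else 0) = (\<Sum>x\<in>B. (w x)\<^sup>2)"
    and "mass (\<lambda>x. if x \<in> - B then w x else 0) = mass w - (\<Sum>x\<in>B. (w x)\<^sup>2)"
proof -
  have "mass (\<lambda>x. if x \<in> B then w x else 0) = (\<Sum>\<^sub>\<infinity>x\<in>B. (w x)\<^sup>2)"
    unfolding mass_def by (rule infsum_cong_neutral) auto
  then show "mass (\<lambda>x. if x \<in> B then w x else 0) = (\<Sum>x\<in>B. (w x)\<^sup>2)"
    using assms(1) by simp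
  have "mass (\<lambda>x. if x \<in> - B then w x else 0) = (\<Sum>\<^sub>\<infinity>x\<in>UNIV - B. (w x)\<^sup>2)"
    unfolding mass_def by (rule infsum_cong_neutral) auto
  also have "\<dots> = mass w - (\<Sum>\<^sub>\<infinity>x\<in>B. (w x)\<^sup>2)"
    unfolding mass_def using assms by (intro infsum_Diff) auto
  finally show "mass (\<lambda>x. if x \<in> - B then w x else 0) = mass w - (\<Sum>x\<in>B. (w x)\<^sup>2)"
    using assms(1) by simp
qed

text \<open>Splitting costs entropy: the lower bound \<open>action_ge\<close> for the two halves adds up to
  \<open>min_action V - p ln p - (1 - p) ln (1 - p)\<close>.\<close>

lemma entropy_of_cut_le:
  assumes V: "\<And>x. V x \<ge> - 1" and w: "w \<in> unit_sphere V" and B: "finite B"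
  defines "p \<equiv> \<Sum>x\<in>B. (w x)\<^sup>2"
  shows "min_action V - p * ln p - (1 - p) * ln (1 - p)
    \<le> action V w + (\<Sum>x\<in>collar B. boundary_term B w x)"
proof -
  define u where "u = (\<lambda>B x. if x \<in> B then w x else 0)"
  have aw: "admissible V w" and mw: "mass w = 1" using w by (auto simp: unit_sphere_def)
  have au: "admissible V (u B)" for B unfolding u_def by (rule admissible_restrict[OF aw])
  have "mass (u B) = p" "mass (u (- B)) = 1 - p"
    using mass_split[OF B] aw mw by (auto simp: u_def p_def admissible_def)
  then have "p * min_action V - p * ln p \<le> action V (u B)"
    "(1 - p) * min_action V - (1 - p) * ln (1 - p) \<le> action V (u (- B))"
    using action_ge[OF V au, of B] action_ge[OF V au, of "- B"] by auto
  moreover have "action V (u B) + action V (u (- B)) = action V w + (\<Sum>x\<in>collar B. boundary_term B w x)"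
  proof -
    have fin: "boundary_term B w summable_on UNIV"
      using boundary_term_outside_collar[of _ B w]
      by (intro finite_nonzero_values_imp_summable_on finite_subset[OF _ finite_collar[OF B]]) auto
    have "(\<Sum>\<^sub>\<infinity>x. boundary_term B w x) = (\<Sum>\<^sub>\<infinity>x\<in>collar B. boundary_term B w x)"
      by (rule infsum_cong_neutral) (auto simp: boundary_term_outside_collar)
    then have cross: "(\<Sum>\<^sub>\<infinity>x. boundary_term B w x) = (\<Sum>x\<in>collar B. boundary_term B w x)"
      using finite_collar[OF B] by simp
    have "action V (u B) + action V (u (- B))
        = (\<Sum>\<^sub>\<infinity>x. action_density V (u B) x + action_density V (u (- B)) x)"
      unfolding action_def by (intro infsum_add[symmetric] summable_action_density au)
    also have "\<dots> = (\<Sum>\<^sub>\<infinity>x. action_density V w x + boundary_term B w x)"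
      by (intro infsum_cong) (simp add: action_density_split[of V w _ B] u_def)
    also have "\<dots> = action V w + (\<Sum>\<^sub>\<infinity>x. boundary_term B w x)"
      unfolding action_def by (intro infsum_add summable_action_density aw fin)
    finally show ?thesis by (simp add: cross)
  qed
  ultimately show ?thesis by (simp add: algebra_simps)
qed

text \<open>The products \<open>w x * w (x + e)\<close> are summable. Once \<open>B\<close> contains a finite set \<open>F\<close> together with its
  neighbours, no edge at a point of \<open>F\<close> crosses the boundary, and only the tail outside \<open>F\<close>
  remains.\<close>

lemma boundary_term_vanishes:
  fixes w :: "int ^ 'n \<Rightarrow> real"
  assumes w: "(\<lambda>x. (w x)\<^sup>2) summable_on UNIV"
  shows "((\<lambda>B. \<Sum>x\<in>collar B. boundary_term B w x) \<longlongrightarrow> 0) (finite_subsets_at_top UNIV)"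
proof (rule tendstoI)
  fix \<epsilon> :: real assume \<epsilon>: "\<epsilon> > 0"
  define q where "q = (\<lambda>x. \<Sum>e\<in>unit_steps. \<bar>w x * w (x + e)\<bar>)"
  have q: "q summable_on UNIV"
    unfolding q_def
  proof (intro summable_on_finite_sum finite_unit_steps)
    fix e :: "int ^ 'n"
    have s: "(\<lambda>x. (w x)\<^sup>2 + (w (x + e))\<^sup>2) summable_on UNIV"
      using summable_on_lattice_shift[of "\<lambda>x. (w x)\<^sup>2" e] by (intro summable_on_add w) (simp add: w)
    have "\<bar>a * b\<bar> \<le> a\<^sup>2 + b\<^sup>2" for a b :: real
    proof -
      have "2 * \<bar>a * b\<bar> \<le> a\<^sup>2 + b\<^sup>2"
        using sum_squares_bound[of "\<bar>a\<bar>" "\<bar>b\<bar>"] by (simp add: abs_mult)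
      then show ?thesis using abs_ge_zero[of "a * b"] by linarith
    qed
    then show "(\<lambda>x. \<bar>w x * w (x + e)\<bar>) summable_on UNIV"
      by (intro summable_on_comparison_test[OF s]) auto
  qed
  then obtain F where F: "finite F" "dist (sum q F) (infsum q UNIV) \<le> \<epsilon> / 2"
    using infsum_finite_approximation[OF q, of "\<epsilon> / 2"] \<epsilon> by auto
  have tail: "infsum q (UNIV - F) \<le> \<epsilon> / 2"
    using infsum_Diff[OF q, of F] F abs_le_D2[OF F(2)[unfolded dist_real_def]] by simp
  \<comment> \<open>If \<open>B\<close> contains \<open>G\<close>, then every edge at a point of \<open>F\<close> lies inside \<open>B\<close>.\<close>
  define G where "G = F \<union> (\<Union>e\<in>unit_steps. (\<lambda>x. x + e) ` F)"
  have G: "finite G" using F by (simp add: G_def finite_unit_steps)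
  have "\<bar>\<Sum>x\<in>collar B. boundary_term B w x\<bar> < \<epsilon>" if B: "finite B" "G \<subseteq> B" for B
  proof -
    have "boundary_term B w x = 0" if "x \<in> F" for x
    proof -
      have "x \<in> B" "\<forall>e\<in>unit_steps. x + e \<in> B" using that B(2) by (auto simp: G_def)
      then show ?thesis by (simp add: boundary_term_def)
    qed
    then have "(\<Sum>x\<in>collar B. boundary_term B w x) = (\<Sum>x\<in>collar B - F. boundary_term B w x)"
      using finite_collar[OF B(1)] by (intro sum.mono_neutral_right) auto
    also have "\<bar>\<dots>\<bar> \<le> (\<Sum>x\<in>collar B - F. \<bar>boundary_term B w x\<bar>)" by (rule sum_abs)
    also have "\<dots> \<le> (\<Sum>x\<in>collar B - F. q x)"
    proof (rule sum_mono)
      fix x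
      have "\<bar>boundary_term B w x\<bar> \<le> (\<Sum>e\<in>unit_steps. \<bar>if (x \<in> B) \<noteq> (x + e \<in> B) then w x * w (x + e) else 0\<bar>)"
        unfolding boundary_term_def by (rule sum_abs)
      also have "\<dots> \<le> q x" unfolding q_def by (rule sum_mono) auto
      finally show "\<bar>boundary_term B w x\<bar> \<le> q x" .
    qed
    also have "\<dots> \<le> infsum q (UNIV - F)"
      using finite_collar[OF B(1)]
      by (intro finite_sum_le_infsum summable_on_subset[OF q]) (auto simp: q_def sum_nonneg)
    finally show ?thesis using tail \<epsilon> by linarith
  qed
  then show "\<forall>\<^sub>F B in finite_subsets_at_top UNIV. dist (\<Sum>x\<in>collar B. boundary_term B w x) 0 < \<epsilon>"
    using G by (auto simp: eventually_finite_subsets_at_top)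
qed

lemma entropy_pos:
  fixes m :: real
  assumes "0 < m" "m < 1"
  shows "- m * ln m - (1 - m) * ln (1 - m) > 0"
proof -
  have "m * ln m < 0" "(1 - m) * ln (1 - m) < 0" using assms by (auto intro: mult_pos_neg)
  then show ?thesis by simp
qed

section \<open>Existence of a minimiser\<close>

text \<open>No mass is lost: the cut inequality survives the pointwise limit for each finite \<open>B\<close>, and as
  \<open>B\<close> grows it shows that the entropy of the splitting into \<open>m = mass l\<close> and \<open>1 - m\<close> is at most
  0. The action of the limit is bounded by Fatou's lemma, here in the form of finite partial sums.\<close>

lemma pointwise_limit_of_minimising_sequence:
  fixes w :: "nat \<Rightarrow> int ^ 'n \<Rightarrow> real"
  assumes V: "\<And>x. V x \<ge> - 1" and w: "\<And>k. w k \<in> unit_sphere V"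
    and min: "(\<lambda>k. action V (w k)) \<longlonglongrightarrow> min_action V"
    and lim: "\<And>x. (\<lambda>k. w k x) \<longlonglongrightarrow> l x" and nz: "l x0 \<noteq> 0"
  shows "l \<in> unit_sphere V \<and> action V l = min_action V"
proof -
  have l1: "\<bar>l x\<bar> \<le> 1" for x
    by (rule tendsto_upperbound[OF tendsto_rabs[OF lim]]) (auto intro!: always_eventually unit_sphere_abs_le_1[OF w])
  have sum_le_1: "(\<Sum>x\<in>F. (l x)\<^sup>2) \<le> 1" if "finite F" for F
  proof (rule tendsto_upperbound)
    show "(\<lambda>k. \<Sum>x\<in>F. (w k x)\<^sup>2) \<longlonglongrightarrow> (\<Sum>x\<in>F. (l x)\<^sup>2)" by (intro tendsto_intros lim)
    show "\<forall>\<^sub>F k in sequentially. (\<Sum>x\<in>F. (w k x)\<^sup>2) \<le> 1"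
      using w finite_sum_le_infsum[OF _ that, of "\<lambda>x. (w _ x)\<^sup>2" UNIV]
      by (intro always_eventually allI) (auto simp: unit_sphere_def mass_def admissible_def)
  qed simp
  have l2: "(\<lambda>x. (l x)\<^sup>2) summable_on UNIV"
    by (rule nonneg_bdd_above_summable_on) (auto intro!: bdd_aboveI2[of _ _ 1] sum_le_1)
  define m where "m = mass l"
  have m_le: "m \<le> 1" unfolding m_def mass_def by (rule infsum_le_finite_sums[OF l2]) (rule sum_le_1)
  have "0 < (l x0)\<^sup>2" using nz by simp
  then have m_pos: "m > 0" using square_le_mass[OF l2, of x0] unfolding m_def by linarith
  have cut: "- p * ln p - (1 - p) * ln (1 - p) \<le> (\<Sum>x\<in>collar B. boundary_term B l x)"
    if B: "finite B" and p: "p = (\<Sum>x\<in>B. (l x)\<^sup>2)" for B p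
  proof -
    define p' where "p' = (\<lambda>k. \<Sum>x\<in>B. (w k x)\<^sup>2)"
    have p': "p' \<longlonglongrightarrow> p" unfolding p'_def p by (intro tendsto_intros lim)
    have xlnx: "(\<lambda>k. f k * ln (f k)) \<longlonglongrightarrow> a * ln a" if "f \<longlonglongrightarrow> a" for f and a :: real
      using isCont_tendsto_compose[OF isCont_mult_ln that] .
    have "(\<lambda>k. min_action V - p' k * ln (p' k) - (1 - p' k) * ln (1 - p' k))
        \<longlonglongrightarrow> min_action V - p * ln p - (1 - p) * ln (1 - p)"
      by (intro tendsto_diff tendsto_const xlnx p')
    moreover have "(\<lambda>k. action V (w k) + (\<Sum>x\<in>collar B. boundary_term B (w k) x))
        \<longlonglongrightarrow> min_action V + (\<Sum>x\<in>collar B. boundary_term B l x)"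
    proof (intro tendsto_add min tendsto_sum)
      show "(\<lambda>k. boundary_term B (w k) x) \<longlonglongrightarrow> boundary_term B l x" for x
        unfolding boundary_term_def
      proof (rule tendsto_sum)
        show "(\<lambda>k. if (x \<in> B) \<noteq> (x + e \<in> B) then w k x * w k (x + e) else 0)
          \<longlonglongrightarrow> (if (x \<in> B) \<noteq> (x + e \<in> B) then l x * l (x + e) else 0)" for e
          using tendsto_mult[OF lim[of x] lim[of "x + e"]]
          by (cases "x \<in> B"; cases "x + e \<in> B") simp_all
      qed
    qed
    ultimately have "min_action V - p * ln p - (1 - p) * ln (1 - p)
        \<le> min_action V + (\<Sum>x\<in>collar B. boundary_term B l x)"
      by (rule LIMSEQ_le) (use entropy_of_cut_le[OF V w B] in \<open>auto simp: p'_def\<close>)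
    then show ?thesis by simp
  qed
  have "m = 1"
  proof (rule ccontr)
    assume "m \<noteq> 1"
    then have "- m * ln m - (1 - m) * ln (1 - m) > 0"
      using m_le m_pos by (intro entropy_pos) auto
    moreover have "- m * ln m - (1 - m) * ln (1 - m) \<le> 0"
    proof (rule tendsto_le[OF _ boundary_term_vanishes[OF l2]])
      have "(sum (\<lambda>x. (l x)\<^sup>2) \<longlongrightarrow> m) (finite_subsets_at_top UNIV)"
        using infsum_tendsto[OF l2] by (simp add: m_def mass_def)
      then have "((\<lambda>B. - (sum (\<lambda>x. (l x)\<^sup>2) B * ln (sum (\<lambda>x. (l x)\<^sup>2) B))
          - (1 - sum (\<lambda>x. (l x)\<^sup>2) B) * ln (1 - sum (\<lambda>x. (l x)\<^sup>2) B)) \<longlongrightarrow> - (m * ln m) - (1 - m) * ln (1 - m))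
          (finite_subsets_at_top UNIV)"
        by (intro tendsto_diff tendsto_minus isCont_tendsto_compose[OF isCont_mult_ln] tendsto_const)
      then show "((\<lambda>B. - sum (\<lambda>x. (l x)\<^sup>2) B * ln (sum (\<lambda>x. (l x)\<^sup>2) B)
          - (1 - sum (\<lambda>x. (l x)\<^sup>2) B) * ln (1 - sum (\<lambda>x. (l x)\<^sup>2) B)) \<longlongrightarrow> - m * ln m - (1 - m) * ln (1 - m))
          (finite_subsets_at_top UNIV)" by simp
      show "\<forall>\<^sub>F B in finite_subsets_at_top UNIV.
          - sum (\<lambda>x. (l x)\<^sup>2) B * ln (sum (\<lambda>x. (l x)\<^sup>2) B)
          - (1 - sum (\<lambda>x. (l x)\<^sup>2) B) * ln (1 - sum (\<lambda>x. (l x)\<^sup>2) B)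
          \<le> (\<Sum>x\<in>collar B. boundary_term B l x)"
        by (rule eventually_finite_subsets_at_top_weakI) (rule cut, auto)
    qed simp
    ultimately show False by simp
  qed
  have density_le: "(\<Sum>x\<in>F. action_density V l x) \<le> min_action V" if F: "finite F" for F
  proof (rule LIMSEQ_le[OF _ min])
    show "(\<lambda>k. \<Sum>x\<in>F. action_density V (w k) x) \<longlonglongrightarrow> (\<Sum>x\<in>F. action_density V l x)"
      unfolding action_density_def grad_sq_def
      by (intro tendsto_intros lim isCont_tendsto_compose[OF isCont_sq_log])
    show "\<exists>N. \<forall>k\<ge>N. (\<Sum>x\<in>F. action_density V (w k) x) \<le> action V (w k)"
      using w unfolding action_def
      by (intro exI allI impI finite_sum_le_infsum summable_action_density F action_density_nonneg
          unit_sphere_abs_le_1[OF w] V) (auto simp: unit_sphere_def)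
  qed
  have dens: "action_density V l summable_on UNIV"
    by (rule nonneg_bdd_above_summable_on)
      (auto intro!: bdd_aboveI2[of _ _ "min_action V"] density_le action_density_nonneg V l1)
  have "l \<in> unit_sphere V"
    using admissible_if_density_summable[OF V l1 l2 dens] \<open>m = 1\<close> by (simp add: unit_sphere_def m_def)
  moreover have "action V l \<le> min_action V"
    unfolding action_def by (rule infsum_le_finite_sums[OF dens]) (rule density_le)
  ultimately show ?thesis
    using cINF_lower[OF bdd_below_action[of V, OF V], of l] by (auto simp: min_action_def)
qed

text \<open>If \<open>w\<^sup>2 < exp (- A)\<close> everywhere, then \<open>- w\<^sup>2 ln w\<^sup>2 \<ge> A w\<^sup>2\<close>, and summation bounds the action below by
  \<open>A\<close>; the summand 1 in the exponent makes this a contradiction.\<close>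

lemma concentration:
  assumes V: "\<And>x. V x \<ge> - 1" and w: "w \<in> unit_sphere V"
  shows "\<exists>x. (w x)\<^sup>2 \<ge> exp (- (action V w + 1))"
proof (rule ccontr)
  define A where "A = action V w + 1"
  assume "\<nexists>x. (w x)\<^sup>2 \<ge> exp (- (action V w + 1))"
  then have small: "(w x)\<^sup>2 < exp (- A)" for x by (auto simp: A_def not_le)
  have aw: "admissible V w" and mw: "mass w = 1" using w by (auto simp: unit_sphere_def)
  have "A * (w x)\<^sup>2 \<le> action_density V w x" for x
  proof -
    have "A * (w x)\<^sup>2 \<le> - sq_log (w x)"
    proof (cases "w x = 0")
      case False
      then have "ln ((w x)\<^sup>2) \<le> ln (exp (- A))" using small[of x] by (subst ln_le_cancel_iff) auto
      then have "(w x)\<^sup>2 * ln ((w x)\<^sup>2) \<le> (w x)\<^sup>2 * (- A)" by (intro mult_left_mono) auto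
      then show ?thesis by (simp add: sq_log_def mult.commute)
    qed simp
    moreover have "(V x + 1) * (w x)\<^sup>2 \<ge> 0" using V[of x] by simp
    ultimately show ?thesis using grad_sq_nonneg[of w x] unfolding action_density_def by linarith
  qed
  then have "(\<Sum>\<^sub>\<infinity>x. A * (w x)\<^sup>2) \<le> action V w"
    unfolding action_def using aw summable_action_density[OF aw]
    by (intro infsum_mono summable_on_cmult_right) (auto simp: admissible_def)
  then show False using mw by (simp add: infsum_cmult_right' mass_def A_def)
qed

lemma translate_unit_sphere:
  fixes w :: "int ^ 'n \<Rightarrow> real" and q :: "int ^ 'n" and T :: nat
  assumes per: "periodic T V" and w: "w \<in> unit_sphere V"
  defines "w' \<equiv> \<lambda>x. w (x + int T *s q)"
  shows "w' \<in> unit_sphere V" "action V w' = action V w"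
proof -
  let ?p = "int T *s q"
  have V: "V x = V (x + ?p)" for x using periodic_shift[OF per] by simp
  have "grad_sq w' x = grad_sq w (x + ?p)" for x
    by (simp add: grad_sq_eq w'_def add_ac)
  then have "action_density V w' x = action_density V w (x + ?p)" for x
    by (simp add: action_density_def w'_def flip: V)
  then show "action V w' = action V w"
    by (simp add: action_def infsum_lattice_shift[of "action_density V w"])
  have "(\<lambda>x. (V x + 1) * (w (x + ?p))\<^sup>2) summable_on UNIV
      \<longleftrightarrow> (\<lambda>x. (V x + 1) * (w x)\<^sup>2) summable_on UNIV"
    using summable_on_lattice_shift[of "\<lambda>x. (V x + 1) * (w x)\<^sup>2" ?p] by (simp flip: V)
  then show "w' \<in> unit_sphere V"
    using w unfolding unit_sphere_def admissible_def mass_def w'_def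
    by (simp add: infsum_lattice_shift[of "\<lambda>x. (w x)\<^sup>2"] summable_on_lattice_shift[of "\<lambda>x. (w x)\<^sup>2"]
        summable_on_lattice_shift[of "\<lambda>x. sq_log (w x)"])
qed

lemma finite_lattice_box: "finite {x :: int ^ 'n. \<forall>i. x $ i \<in> {a..<b}}"
proof -
  have "{x :: int ^ 'n. \<forall>i. x $ i \<in> {a..<b}} \<subseteq> vec_lambda ` (\<Pi>\<^sub>E i\<in>UNIV. {a..<b})"
    by (force intro: image_eqI[where x = "vec_nth _"])
  then show ?thesis by (rule finite_subset) (intro finite_imageI finite_PiE; simp)
qed

text \<open>The members of a minimising sequence are translated so that the place where they concentrate
  falls into a fundamental box of the period lattice; being finite, the box keeps some mass in the
  limit.\<close>

lemma minimiser_exists: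
  fixes V :: "int ^ 'n \<Rightarrow> real"
  assumes V: "\<And>x. V x \<ge> - 1" and per: "periodic T V" and T: "T > 0"
  shows "\<exists>w\<in>unit_sphere V. action V w = min_action V"
proof -
  have "\<exists>v\<in>unit_sphere V. action V v < min_action V + 1 / real (Suc k)" for k
    using cINF_less_iff[OF unit_sphere_nonempty bdd_below_action[of V, OF V], of "min_action V + 1 / real (Suc k)"]
    by (simp add: min_action_def)
  then obtain v where v: "\<And>k. v k \<in> unit_sphere V" "\<And>k. action V (v k) < min_action V + 1 / real (Suc k)"
    by metis
  \<comment> \<open>The actions of the sequence are at most \<open>min_action V + 1\<close>, and \<open>concentration\<close> adds another 1.\<close>
  define \<delta> where "\<delta> = exp (- (min_action V + 2))"
  have "\<exists>x. (v k x)\<^sup>2 \<ge> \<delta>" for k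
  proof -
    have "1 / real (Suc k) \<le> 1" by simp
    then have "\<delta> \<le> exp (- (action V (v k) + 1))" using v(2)[of k] unfolding \<delta>_def exp_le_cancel_iff by linarith
    then show ?thesis using concentration[OF V v(1)[of k]] by (meson order_trans)
  qed
  then obtain x where x: "\<And>k. (v k (x k))\<^sup>2 \<ge> \<delta>" by metis
  \<comment> \<open>The cell of the period lattice that contains \<open>x k\<close>, and the position \<open>r k\<close> of \<open>x k\<close> in it.\<close>
  define q where "q k = (\<chi> i. x k $ i div int T)" for k
  define r where "r k = (\<chi> i. x k $ i mod int T)" for k
  have x_eq: "r k + int T *s q k = x k" for k
    by (simp add: vec_eq_iff q_def r_def)
  define w where "w k = (\<lambda>x. v k (x + int T *s q k))" for k
  have w: "w k \<in> unit_sphere V" "action V (w k) = action V (v k)" for k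
    unfolding w_def using translate_unit_sphere[OF per v(1)] by auto
  define Box where "Box = {x :: int ^ 'n. \<forall>i. x $ i \<in> {0..<int T}}"
  have Box: "finite Box" unfolding Box_def by (rule finite_lattice_box)
  have in_box: "(\<Sum>x\<in>Box. (w k x)\<^sup>2) \<ge> \<delta>" for k
  proof -
    have "r k \<in> Box" using T by (simp add: Box_def r_def)
    then have "(w k (r k))\<^sup>2 \<le> (\<Sum>x\<in>Box. (w k x)\<^sup>2)" using Box by (intro member_le_sum) auto
    then show ?thesis using x[of k] by (simp add: w_def x_eq)
  qed
  obtain s l where s: "strict_mono (s :: nat \<Rightarrow> nat)" and l: "\<And>x. (\<lambda>k. w (s k) x) \<longlonglongrightarrow> l x"
    using pointwise_convergent_subsequence[of w] unit_sphere_abs_le_1[OF w(1)] by blast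
  have "(\<Sum>x\<in>Box. (l x)\<^sup>2) \<ge> \<delta>"
  proof (rule tendsto_lowerbound)
    show "(\<lambda>k. \<Sum>x\<in>Box. (w (s k) x)\<^sup>2) \<longlonglongrightarrow> (\<Sum>x\<in>Box. (l x)\<^sup>2)" by (intro tendsto_intros l)
  qed (auto simp: in_box)
  moreover have "\<delta> > 0" by (simp add: \<delta>_def)
  ultimately have "\<exists>x\<in>Box. (l x)\<^sup>2 \<noteq> 0" by (metis not_less sum.neutral)
  then obtain x0 where "l x0 \<noteq> 0" by auto
  moreover have "(\<lambda>k. action V (w (s k))) \<longlonglongrightarrow> min_action V"
  proof (rule LIMSEQ_subseq_LIMSEQ[OF _ s, unfolded o_def])
    have "(\<lambda>k. min_action V + 1 / real (Suc k)) \<longlonglongrightarrow> min_action V + 0"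
      by (intro tendsto_intros LIMSEQ_inverse_real_of_nat[unfolded inverse_eq_divide])
    then have upper: "(\<lambda>k. min_action V + 1 / real (Suc k)) \<longlonglongrightarrow> min_action V" by simp
    have lower: "min_action V \<le> action V (w k)" for k
      unfolding min_action_def by (intro cINF_lower bdd_below_action V w)
    have le: "action V (w k) \<le> min_action V + 1 / real (Suc k)" for k
      using v(2)[of k] w(2)[of k] by linarith
    show "(\<lambda>k. action V (w k)) \<longlonglongrightarrow> min_action V"
      by (rule tendsto_sandwich[OF always_eventually always_eventually tendsto_const upper])
        (simp_all only: lower le simp_thms)
  qed
  ultimately have "l \<in> unit_sphere V \<and> action V l = min_action V"
    using pointwise_limit_of_minimising_sequence[of V "\<lambda>k. w (s k)" l x0] V w(1) l by blast
  then show ?thesis by blast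
qed

text \<open>By the reverse triangle inequality, taking absolute values can only lower the gradient term, and it
  preserves the other two.\<close>

lemma abs_minimiser:
  assumes V: "\<And>x. V x \<ge> - 1" and w: "w \<in> unit_sphere V" "action V w = min_action V"
  shows "(\<lambda>x. \<bar>w x\<bar>) \<in> unit_sphere V" "action V (\<lambda>x. \<bar>w x\<bar>) = min_action V"
proof -
  have sl: "sq_log \<bar>s\<bar> = sq_log s" for s by (simp add: sq_log_def)
  show sph: "(\<lambda>x. \<bar>w x\<bar>) \<in> unit_sphere V"
    using w by (simp add: unit_sphere_def admissible_def mass_def sl)
  have "grad_sq (\<lambda>x. \<bar>w x\<bar>) x \<le> grad_sq w x" for x
    unfolding grad_sq_def by (intro mult_left_mono sum_mono) (auto simp: abs_le_square_iff[symmetric])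
  then have "action V (\<lambda>x. \<bar>w x\<bar>) \<le> action V w"
    unfolding action_def using sph w
    by (intro infsum_mono summable_action_density) (auto simp: unit_sphere_def action_density_def sl)
  moreover have "min_action V \<le> action V (\<lambda>x. \<bar>w x\<bar>)"
    unfolding min_action_def by (intro cINF_lower bdd_below_action V sph)
  ultimately show "action V (\<lambda>x. \<bar>w x\<bar>) = min_action V" using w by simp
qed

section \<open>The Euler-Lagrange equation\<close>

lemma finite_change:
  fixes f g :: "'a \<Rightarrow> real"
  assumes f: "f summable_on UNIV" and F: "finite F" and eq: "\<And>x. x \<notin> F \<Longrightarrow> g x = f x"
  shows summable_on_finite_change: "g summable_on UNIV"
    and infsum_finite_change: "infsum g UNIV = infsum f UNIV + (\<Sum>x\<in>F. g x - f x)"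
proof -
  have "((\<lambda>x. g x - f x) has_sum (\<Sum>x\<in>F. g x - f x)) UNIV"
    by (rule has_sum_finite_neutralI[OF F]) (auto simp: eq)
  from has_sum_add[OF has_sum_infsum[OF f] this]
  have "(g has_sum (infsum f UNIV + (\<Sum>x\<in>F. g x - f x))) UNIV" by simp
  then show "g summable_on UNIV" "infsum g UNIV = infsum f UNIV + (\<Sum>x\<in>F. g x - f x)"
    by (auto simp: has_sum_iff)
qed

text \<open>Only \<open>x\<close> and its neighbours contribute to the change. Each edge at \<open>x\<close> is counted with weight one half
  at both of its ends, whence the full weight in the sum over the edges.\<close>

lemma point_change:
  fixes w :: "int ^ 'n \<Rightarrow> real" and V :: "int ^ 'n \<Rightarrow> real" and x :: "int ^ 'n" and s :: real
  defines "w' \<equiv> w(x := s)"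
  assumes w: "admissible V w"
  shows admissible_point_change: "admissible V w'"
    and mass_point_change: "mass w' = mass w + (s\<^sup>2 - (w x)\<^sup>2)"
    and action_point_change: "action V w' = action V w
      + (\<Sum>y | x \<sim> y. (s - w y)\<^sup>2 - (w x - w y)\<^sup>2)
      + (V x + 1) * (s\<^sup>2 - (w x)\<^sup>2) - (sq_log s - sq_log (w x))"
proof -
  let ?N = "{y. x \<sim> y}"
  note aw = w[unfolded admissible_def]
  have off: "w' y = w y" if "y \<notin> {x}" for y using that by (simp add: w'_def)
  show aw': "admissible V w'"
    unfolding admissible_def
    using summable_on_finite_change[of "\<lambda>x. (w x)\<^sup>2" "{x}" "\<lambda>x. (w' x)\<^sup>2"]
      summable_on_finite_change[of "\<lambda>x. (V x + 1) * (w x)\<^sup>2" "{x}" "\<lambda>x. (V x + 1) * (w' x)\<^sup>2"]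
      summable_on_finite_change[of "\<lambda>x. sq_log (w x)" "{x}" "\<lambda>x. sq_log (w' x)"]
    using aw off by simp
  show "mass w' = mass w + (s\<^sup>2 - (w x)\<^sup>2)"
    unfolding mass_def
    using infsum_finite_change[of "\<lambda>x. (w x)\<^sup>2" "{x}" "\<lambda>x. (w' x)\<^sup>2"] aw off by (simp add: w'_def)
  have sym: "y \<sim> x \<longleftrightarrow> x \<sim> y" for y by (simp add: adj_def abs_minus_commute)
  have irrefl: "\<not> x \<sim> x" for x :: "int ^ 'n" by (simp add: adj_def)
  have gx: "grad_sq w' x - grad_sq w x = (\<Sum>y | x \<sim> y. ((s - w y)\<^sup>2 - (w x - w y)\<^sup>2) / 2)"
  proof -
    have "(\<Sum>y | x \<sim> y. (w' y - w' x)\<^sup>2) = (\<Sum>y | x \<sim> y. (s - w y)\<^sup>2)"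
      by (rule sum.cong) (auto simp: w'_def irrefl power2_commute)
    then show ?thesis
      by (simp add: grad_sq_def sum_subtractf diff_divide_distrib sum_divide_distrib power2_commute[of "w x"])
  qed
  have gz: "grad_sq w' z - grad_sq w z = ((s - w z)\<^sup>2 - (w x - w z)\<^sup>2) / 2" if z: "x \<sim> z" for z
  proof -
    have zx: "z \<noteq> x" "x \<in> {y. z \<sim> y}" using z irrefl sym by auto
    have "(\<Sum>y\<in>{y. z \<sim> y} - {x}. (w' y - w' z)\<^sup>2) = (\<Sum>y\<in>{y. z \<sim> y} - {x}. (w y - w z)\<^sup>2)"
      using zx by (intro sum.cong) (auto simp: w'_def)
    then show ?thesis
      using zx(1) sum.remove[OF finite_neighbours zx(2), of "\<lambda>y. (w' y - w' z)\<^sup>2"]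
        sum.remove[OF finite_neighbours zx(2), of "\<lambda>y. (w y - w z)\<^sup>2"]
      by (simp add: grad_sq_def w'_def field_simps)
  qed
  have "action V w' = action V w + (\<Sum>z\<in>insert x ?N. action_density V w' z - action_density V w z)"
    unfolding action_def
  proof (rule infsum_finite_change[OF summable_action_density[OF w]])
    fix z assume z: "z \<notin> insert x ?N"
    then have "x \<notin> {y. z \<sim> y}" using sym by auto
    then have "grad_sq w' z = grad_sq w z"
      unfolding grad_sq_def using z by (intro arg_cong2[of _ _ _ _ "(*)"] sum.cong) (auto simp: w'_def)
    then show "action_density V w' z = action_density V w z"
      using z by (simp add: action_density_def w'_def)
  qed (simp add: finite_neighbours)
  also have "(\<Sum>z\<in>insert x ?N. action_density V w' z - action_density V w z)
      = (action_density V w' x - action_density V w x) + (\<Sum>z\<in>?N. action_density V w' z - action_density V w z)"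
    using irrefl by (simp add: finite_neighbours)
  also have "(\<Sum>z\<in>?N. action_density V w' z - action_density V w z)
      = (\<Sum>z\<in>?N. ((s - w z)\<^sup>2 - (w x - w z)\<^sup>2) / 2)"
  proof (rule sum.cong)
    fix z assume "z \<in> ?N"
    then have "x \<sim> z" "z \<noteq> x" using irrefl by auto
    then show "action_density V w' z - action_density V w z = ((s - w z)\<^sup>2 - (w x - w z)\<^sup>2) / 2"
      using gz[of z] by (simp add: action_density_def w'_def)
  qed simp
  also have "action_density V w' x - action_density V w x = (\<Sum>z\<in>?N. ((s - w z)\<^sup>2 - (w x - w z)\<^sup>2) / 2)
      + (V x + 1) * (s\<^sup>2 - (w x)\<^sup>2) - (sq_log s - sq_log (w x))"
    using gx by (simp add: action_density_def w'_def algebra_simps)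
  finally show "action V w' = action V w
      + (\<Sum>y | x \<sim> y. (s - w y)\<^sup>2 - (w x - w y)\<^sup>2)
      + (V x + 1) * (s\<^sup>2 - (w x)\<^sup>2) - (sq_log s - sq_log (w x))"
    by (simp flip: sum_divide_distrib)
qed

text \<open>Changing the single value at \<open>x\<close> to \<open>s\<close> leaves the sphere, so the homogeneous inequality
  \<open>action_ge\<close> is used instead of minimality: it is an equality at \<open>s = w x\<close>, and the difference of its
  sides, up to a constant the function \<open>K\<close> below, is a differentiable function of the real variable
  \<open>s\<close> with a minimum there.\<close>

lemma euler_lagrange:
  fixes w :: "int ^ 'n \<Rightarrow> real"
  assumes V: "\<And>x. V x \<ge> - 1" and w: "w \<in> unit_sphere V" and min: "action V w = min_action V"
  shows "- laplacian w x + V x * w x = w x * ln ((w x)\<^sup>2) + (min_action V - 1) * w x"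
proof -
  let ?a = "w x"
  have aw: "admissible V w" and mw: "mass w = 1" using w by (auto simp: unit_sphere_def)
  \<comment> \<open>The mass of \<open>w(x := s)\<close>; it is 1 at \<open>s = w x\<close>, so the derivative of \<open>M ln M\<close> there is \<open>2 * w x\<close>.\<close>
  define M where "M s = 1 + (s\<^sup>2 - ?a\<^sup>2)" for s
  define K where "K s = (\<Sum>y | x \<sim> y. (s - w y)\<^sup>2) + (V x + 1) * s\<^sup>2 - sq_log s
      - M s * min_action V + M s * ln (M s)" for s
  have "K ?a \<le> K s" for s
  proof -
    have "M s * min_action V - M s * ln (M s) \<le> action V (w(x := s))"
      using action_ge[OF V admissible_point_change[OF aw, of x s]] mass_point_change[OF aw, of x s]
      by (simp add: mw M_def)
    also have "\<dots> = min_action V + ((\<Sum>y | x \<sim> y. (s - w y)\<^sup>2) - (\<Sum>y | x \<sim> y. (?a - w y)\<^sup>2))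
        + (V x + 1) * (s\<^sup>2 - ?a\<^sup>2) - (sq_log s - sq_log ?a)"
      using action_point_change[OF aw, of x s] min by (simp add: sum_subtractf)
    finally show ?thesis by (simp add: K_def M_def algebra_simps)
  qed
  moreover have "DERIV K ?a :> (\<Sum>y | x \<sim> y. 2 * (?a - w y)) + (V x + 1) * (2 * ?a)
      - (2 * ?a * ln (?a\<^sup>2) + 2 * ?a) - 2 * ?a * min_action V + 2 * ?a"
    unfolding K_def M_def by (auto intro!: derivative_eq_intros DERIV_sq_log)
  ultimately have "(\<Sum>y | x \<sim> y. 2 * (?a - w y)) + (V x + 1) * (2 * ?a)
      - (2 * ?a * ln (?a\<^sup>2) + 2 * ?a) - 2 * ?a * min_action V + 2 * ?a = 0"
    using DERIV_local_min[of K _ ?a 1] by simp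
  moreover have "(\<Sum>y | x \<sim> y. 2 * (?a - w y)) = - 2 * laplacian w x"
    unfolding laplacian_def by (simp add: sum_distrib_left algebra_simps flip: sum_negf)
  ultimately show ?thesis by (simp add: algebra_simps)
qed

text \<open>At a zero of \<open>w\<close> the Laplacian is the sum of the values of \<open>w\<close> at the neighbours, so these vanish
  as well. The zeros therefore propagate over the whole lattice.\<close>

lemma strong_maximum_principle:
  fixes w :: "int ^ 'n \<Rightarrow> real"
  assumes nonneg: "\<And>x. w x \<ge> 0" and nz: "w \<noteq> (\<lambda>x. 0)"
    and lap: "\<And>x. w x = 0 \<Longrightarrow> laplacian w x = 0"
  shows "w x > 0"
proof (rule ccontr)
  assume "\<not> w x > 0"
  then have x: "w x = 0" using nonneg[of x] by simp
  have step: "w (z + e) = 0" if z: "w z = 0" and e: "e \<in> unit_steps" for z e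
  proof -
    have "(\<Sum>e\<in>unit_steps. w (z + e)) = 0"
      using lap[OF z] z by (simp add: laplacian_def sum_neighbours)
    then show ?thesis
      using e by (simp add: sum_nonneg_eq_0_iff finite_unit_steps nonneg)
  qed
  have "w (x + q) = 0" for q
  proof (induction q rule: lattice_induct)
    case (2 q i)
    then show ?case using step[of "x + q" "axis i 1"] axis_unit_step[of i] by (simp add: add.assoc)
  next
    case (3 q i)
    then show ?case using step[of "x + q" "- axis i 1"] uminus_unit_step[THEN iffD2, OF axis_unit_step[of i]]
      by (simp add: add_diff_eq)
  qed (simp add: x)
  then have "w y = 0" for y by (metis add.commute diff_add_cancel)
  then show False using nz by auto
qed

section \<open>The energy and the Nehari manifold\<close>

text \<open>The discrete gradient is bounded on \<open>\<ell>\<^sup>2\<close>, so the norm of \<open>H1\<close> is equivalent to that of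
  \<open>\<ell>\<^sup>2\<close>, in which truncations to finite sets are dense.\<close>

lemma H1_iff_square_summable:
  fixes u :: "int ^ 'n \<Rightarrow> real"
  shows "u \<in> H1 \<longleftrightarrow> (\<lambda>x. (u x)\<^sup>2) summable_on UNIV"
proof
  assume "u \<in> H1"
  then have "H1_density u summable_on UNIV"
    by (simp add: H1_def integrable_count_space_iff_summable_on)
  then show "(\<lambda>x. (u x)\<^sup>2) summable_on UNIV"
    by (rule summable_on_comparison_test) (simp_all add: H1_density_def grad_sq_nonneg)
next
  assume u: "(\<lambda>x. (u x)\<^sup>2) summable_on UNIV"
  have dens: "H1_density v summable_on UNIV" if "(\<lambda>x. (v x)\<^sup>2) summable_on UNIV" for v :: "int ^ 'n \<Rightarrow> real"
    unfolding H1_density_def using that by (intro summable_on_add summable_grad_sq)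
  define C where "C = 2 * real (card (unit_steps :: (int ^ 'n) set)) + 1"
  have C: "C \<ge> 1" by (simp add: C_def)
  have norm_le: "H1_norm v \<le> sqrt (C * mass v)" if v: "(\<lambda>x. (v x)\<^sup>2) summable_on UNIV" for v :: "int ^ 'n \<Rightarrow> real"
  proof -
    have "(\<integral>x. H1_density v x \<partial>count_space UNIV) = infsum (H1_density v) UNIV"
      by (rule integral_count_space_eq_infsum[OF dens[OF v]])
    also have "\<dots> = infsum (grad_sq v) UNIV + mass v"
      unfolding H1_density_def mass_def by (intro infsum_add summable_grad_sq v)
    also have "\<dots> \<le> C * mass v"
      using infsum_grad_sq_le[OF v] by (simp add: C_def algebra_simps)
    finally show ?thesis by (simp add: H1_norm_def)
  qed
  have "\<exists>\<phi>. finite {x. \<phi> x \<noteq> 0} \<and> H1_norm (\<lambda>x. u x - \<phi> x) \<le> 1 / real (Suc k)" for k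
  proof -
    \<comment> \<open>Chosen so that a tail of mass \<open>\<epsilon>\<close> has \<open>H1_norm\<close> at most \<open>1 / Suc k\<close>.\<close>
    define \<epsilon> where "\<epsilon> = (1 / real (Suc k))\<^sup>2 / C"
    have "\<epsilon> > 0" using C by (simp add: \<epsilon>_def)
    then obtain F where F: "finite F" "dist (\<Sum>x\<in>F. (u x)\<^sup>2) (mass u) \<le> \<epsilon>"
      using infsum_finite_approximation[OF u] unfolding mass_def by blast
    define \<phi> where "\<phi> = (\<lambda>x. if x \<in> F then u x else 0)"
    have rest: "(\<lambda>x. u x - \<phi> x) = (\<lambda>x. if x \<in> - F then u x else 0)"
      by (auto simp: \<phi>_def)
    have "(\<lambda>x. (u x - \<phi> x)\<^sup>2) summable_on UNIV"
      by (rule summable_on_comparison_test[OF u]) (auto simp: \<phi>_def)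
    then have "H1_norm (\<lambda>x. u x - \<phi> x) \<le> sqrt (C * mass (\<lambda>x. u x - \<phi> x))" by (rule norm_le)
    also have "mass (\<lambda>x. u x - \<phi> x) = mass u - (\<Sum>x\<in>F. (u x)\<^sup>2)"
      unfolding rest by (rule mass_split(2)[OF F(1) u])
    also have "sqrt (C * (mass u - (\<Sum>x\<in>F. (u x)\<^sup>2))) \<le> sqrt (C * \<epsilon>)"
      using abs_le_D2[OF F(2)[unfolded dist_real_def]] C by (intro real_sqrt_le_mono mult_left_mono) auto
    also have "\<dots> = 1 / real (Suc k)" using C by (simp add: \<epsilon>_def real_sqrt_divide)
    finally show ?thesis using F(1) by (intro exI[of _ \<phi>]) (auto simp: \<phi>_def)
  qed
  then obtain \<phi> where \<phi>: "\<And>k. finite {x. \<phi> k x \<noteq> 0}" "\<And>k. H1_norm (\<lambda>x. u x - \<phi> k x) \<le> 1 / real (Suc k)"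
    by metis
  have "(\<lambda>k. H1_norm (\<lambda>x. u x - \<phi> k x)) \<longlonglongrightarrow> 0"
  proof (rule tendsto_sandwich[OF _ _ tendsto_const])
    show "(\<lambda>k. 1 / real (Suc k)) \<longlonglongrightarrow> 0"
      using LIMSEQ_inverse_real_of_nat by (simp add: inverse_eq_divide)
    have "0 \<le> H1_norm v" for v :: "int ^ 'n \<Rightarrow> real"
      unfolding H1_norm_def H1_density_def by (intro real_sqrt_ge_zero integral_nonneg) (simp add: grad_sq_nonneg)
    then show "\<forall>\<^sub>F k in sequentially. 0 \<le> H1_norm (\<lambda>x. u x - \<phi> k x)" by simp
  qed (use \<phi>(2) in \<open>auto intro!: always_eventually simp del: of_nat_Suc\<close>)
  then show "u \<in> H1"
    using \<phi>(1) dens[OF u] by (auto simp: H1_def integrable_count_space_iff_summable_on)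
qed

lemma energy_eq_action:
  assumes u: "admissible V u"
  shows "energy V u = ereal (action V u / 2)"
proof -
  have "(\<lambda>x. grad_sq u x + (V x + 1) * (u x)\<^sup>2) summable_on UNIV"
    using u unfolding admissible_def by (intro summable_on_add summable_grad_sq) auto
  moreover have "(\<lambda>x. (u x)\<^sup>2 * ln ((u x)\<^sup>2)) summable_on UNIV"
    using u by (simp add: admissible_def sq_log_def)
  ultimately show ?thesis
    unfolding energy_def action_eq[OF u] by (simp add: ext_integral_eq_infsum sq_log_def diff_divide_distrib)
qed

text \<open>This dominates the positive part of the logarithmic term by a summable function.\<close>

lemma sq_log_le:
  assumes "(\<lambda>x. (u x)\<^sup>2) summable_on UNIV"
  shows "sq_log (u x) \<le> mass u * (u x)\<^sup>2"
proof (cases "u x = 0")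
  case False
  then have "ln ((u x)\<^sup>2) \<le> (u x)\<^sup>2" using ln_le_minus_one[of "(u x)\<^sup>2"] by simp
  also have "\<dots> \<le> mass u" by (rule square_le_mass[OF assms])
  finally have "(u x)\<^sup>2 * ln ((u x)\<^sup>2) \<le> (u x)\<^sup>2 * mass u" by (intro mult_left_mono) auto
  then show ?thesis by (simp add: sq_log_def mult.commute)
qed simp

text \<open>The positive part of the logarithmic term is always summable, and so are the gradient and potential
  parts on \<open>X_space V\<close>. The energy can hence only be infinite through the negative part of the
  logarithmic term.\<close>

lemma energy_domain_iff_admissible:
  fixes u :: "int ^ 'n \<Rightarrow> real"
  assumes V: "\<And>x. V x \<ge> - 1"
  shows "u \<in> energy_domain V \<longleftrightarrow> admissible V u"
proof
  assume u: "admissible V u"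
  then have "u \<in> X_space V"
    by (simp add: X_space_def H1_iff_square_summable admissible_def ext_integral_eq_infsum)
  then show "u \<in> energy_domain V"
    using u by (simp add: energy_domain_def energy_eq_action)
next
  assume "u \<in> energy_domain V"
  then have "u \<in> H1" and pot: "ext_integral (\<lambda>x. (V x + 1) * (u x)\<^sup>2) < \<infinity>" and J: "energy V u < \<infinity>"
    by (auto simp: energy_domain_def X_space_def)
  then have u: "(\<lambda>x. (u x)\<^sup>2) summable_on UNIV" by (simp add: H1_iff_square_summable)
  have pot_nonneg: "(V x + 1) * (u x)\<^sup>2 \<ge> 0" for x using V[of x] by simp
  have "(\<integral>\<^sup>+ x. ennreal (- ((V x + 1) * (u x)\<^sup>2)) \<partial>count_space UNIV) = 0"
    using pot_nonneg by (simp add: ennreal_neg)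
  then have "enn2ereal (\<integral>\<^sup>+ x. ennreal ((V x + 1) * (u x)\<^sup>2) \<partial>count_space UNIV) \<noteq> \<infinity>"
    using pot unfolding ext_integral_def by (simp add: zero_ennreal.rep_eq)
  then have "(\<integral>\<^sup>+ x. ennreal ((V x + 1) * (u x)\<^sup>2) \<partial>count_space UNIV) < \<infinity>"
    by (auto simp: less_top[symmetric])
  then have pot': "(\<lambda>x. (V x + 1) * (u x)\<^sup>2) summable_on UNIV"
    by (intro nn_integral_finite_imp_summable pot_nonneg)
  have quad: "(\<lambda>x. grad_sq u x + (V x + 1) * (u x)\<^sup>2) summable_on UNIV"
    by (intro summable_on_add summable_grad_sq u pot')
  have trunc: "ennreal (max 0 r) = ennreal r" for r :: real by (simp add: max_def ennreal_neg)
  have pos: "(\<lambda>x. max 0 (sq_log (u x))) summable_on UNIV"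
    by (rule summable_on_comparison_test[OF summable_on_cmult_right[OF u, of "mass u"]])
      (use sq_log_le[OF u] mass_nonneg[of u] in auto)
  define P where "P = (\<Sum>\<^sub>\<infinity>x. max 0 (sq_log (u x)))"
  define N where "N = (\<integral>\<^sup>+ x. ennreal (- sq_log (u x)) \<partial>count_space UNIV)"
  have P: "(\<integral>\<^sup>+ x. ennreal (sq_log (u x)) \<partial>count_space UNIV) = ennreal P" "P \<ge> 0"
    using nn_integral_count_space_eq_infsum[OF _ pos] by (simp_all add: trunc P_def infsum_nonneg)
  have "N < \<infinity>"
  proof (rule ccontr)
    assume "\<not> N < \<infinity>"
    then have "N = \<infinity>" by (simp add: less_top[symmetric])
    then have "ext_integral (\<lambda>x. (u x)\<^sup>2 * ln ((u x)\<^sup>2)) = - \<infinity>"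
      using P unfolding ext_integral_def sq_log_def N_def by (simp add: enn2ereal_ennreal)
    then show False
      using J unfolding energy_def by (simp add: ext_integral_eq_infsum[OF quad])
  qed
  then have neg: "(\<lambda>x. max 0 (- sq_log (u x))) summable_on UNIV"
    by (intro nn_integral_finite_imp_summable) (simp_all add: trunc N_def)
  have "(\<lambda>x. max 0 (sq_log (u x)) + - max 0 (- sq_log (u x))) summable_on UNIV"
    by (intro summable_on_add pos summable_on_uminus[THEN iffD2] neg)
  moreover have "max 0 r + - max 0 (- r) = r" for r :: real by auto
  ultimately show "admissible V u" using u pot' by (simp add: admissible_def)
qed

lemma nehari_iff:
  fixes u :: "int ^ 'n \<Rightarrow> real"
  assumes V: "\<And>x. V x \<ge> - 1"
  shows "u \<in> nehari V \<longleftrightarrow> admissible V u \<and> mass u > 0 \<and> action V u = mass u"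
proof -
  have "u \<noteq> (\<lambda>x. 0) \<longleftrightarrow> mass u > 0" if "admissible V u"
    using that mass_eq_0_iff[of u] mass_nonneg[of u] by (auto simp: admissible_def less_le)
  moreover have "ext_integral (\<lambda>x. grad_sq u x + V x * (u x)\<^sup>2) = ext_integral (\<lambda>x. (u x)\<^sup>2 * ln ((u x)\<^sup>2))
      \<longleftrightarrow> action V u = mass u" if u: "admissible V u"
  proof -
    note au = u[unfolded admissible_def]
    have quad: "(\<lambda>x. grad_sq u x + (V x + 1) * (u x)\<^sup>2) summable_on UNIV"
      using au by (intro summable_on_add summable_grad_sq) auto
    have "((\<lambda>x. (grad_sq u x + (V x + 1) * (u x)\<^sup>2) + - (u x)\<^sup>2)
        has_sum ((\<Sum>\<^sub>\<infinity>x. grad_sq u x + (V x + 1) * (u x)\<^sup>2) + - mass u)) UNIV"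
      using au quad unfolding mass_def by (intro has_sum_add) (auto simp: has_sum_uminus)
    then have "((\<lambda>x. grad_sq u x + V x * (u x)\<^sup>2)
        has_sum ((\<Sum>\<^sub>\<infinity>x. grad_sq u x + (V x + 1) * (u x)\<^sup>2) - mass u)) UNIV"
      by (simp add: algebra_simps)
    then have "ext_integral (\<lambda>x. grad_sq u x + V x * (u x)\<^sup>2)
        = ereal ((\<Sum>\<^sub>\<infinity>x. grad_sq u x + (V x + 1) * (u x)\<^sup>2) - mass u)"
      by (simp add: has_sum_iff ext_integral_eq_infsum)
    moreover have "ext_integral (\<lambda>x. (u x)\<^sup>2 * ln ((u x)\<^sup>2)) = ereal (\<Sum>\<^sub>\<infinity>x. sq_log (u x))"
      using au by (simp add: sq_log_def ext_integral_eq_infsum)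
    ultimately show ?thesis using action_eq[OF u] by auto
  qed
  ultimately show ?thesis
    by (auto simp: nehari_def energy_domain_iff_admissible[OF V])
qed

section \<open>Ground states\<close>

theorem theorem1p2:
  fixes V :: "int ^ 'n \<Rightarrow> real" and T :: nat
  assumes "(INF x. ereal (V x)) > ereal (- 1)"
    and "T > 0" and "periodic T V"
  shows "\<exists>u. ground_state V u \<and> ((\<forall>x. u x > 0) \<or> (\<forall>x. u x < 0))"
proof -
  have V: "V x \<ge> - 1" for x
  proof -
    have "ereal (- 1) < ereal (V x)" using assms(1) by (rule less_le_trans) (rule INF_lower, simp)
    then show ?thesis by simp
  qed
  obtain v where v: "v \<in> unit_sphere V" "action V v = min_action V"
    using minimiser_exists[of V, OF V assms(3,2)] by blast
  define w where "w = (\<lambda>x. \<bar>v x\<bar>)"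
  have w: "w \<in> unit_sphere V" "action V w = min_action V"
    using abs_minimiser[of V, OF V v] by (simp_all add: w_def)
  have aw: "admissible V w" and mw: "mass w = 1" using w by (auto simp: unit_sphere_def)
  define c where "c = min_action V - 1"
  have eq: "- laplacian w x + V x * w x = w x * ln ((w x)\<^sup>2) + c * w x" for x
    using euler_lagrange[of V, OF V w] by (simp add: c_def)
  have w_pos: "w x > 0" for x
  proof (rule strong_maximum_principle)
    show "w \<noteq> (\<lambda>x. 0)" using mw by (auto simp: mass_def)
    show "laplacian w x = 0" if "w x = 0" for x using eq[of x] that by simp
  qed (simp add: w_def)
  \<comment> \<open>The factor that brings \<open>w\<close> to the Nehari manifold; its square contributes \<open>c\<close> to the logarithm
    and thereby absorbs the multiplier.\<close>
  define a where "a = exp (c / 2)"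
  have a: "a > 0" "a\<^sup>2 = exp c" by (simp_all add: a_def power2_eq_square flip: exp_add)
  define u where "u = (\<lambda>x. a * w x)"
  have au: "admissible V u" unfolding u_def using a by (intro admissible_scale aw) auto
  have mu: "mass u = exp c" by (simp add: u_def mass_scale mw a)
  have "action V u = exp c"
    unfolding u_def using action_scale[OF aw, of a] a by (simp add: mw w c_def algebra_simps)
  then have u_nehari: "u \<in> nehari V" and Ju: "energy V u = ereal (exp c / 2)"
    using au mu by (simp_all add: nehari_iff[of V, OF V] energy_eq_action)
  have solves: "- laplacian u x + V x * u x = u x * ln ((u x)\<^sup>2)" for x
  proof -
    have "laplacian u x = a * laplacian w x"
      by (simp add: laplacian_def u_def sum_distrib_left algebra_simps)
    then have "- laplacian u x + V x * u x = a * (- laplacian w x + V x * w x)"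
      by (simp add: u_def algebra_simps)
    also have "\<dots> = u x * (c + ln ((w x)\<^sup>2))" unfolding eq by (simp add: u_def algebra_simps)
    also have "c + ln ((w x)\<^sup>2) = ln ((u x)\<^sup>2)"
      using w_pos[of x] a by (simp add: u_def power_mult_distrib ln_mult)
    finally show ?thesis .
  qed
  have "energy V u \<le> energy V z" if "z \<in> nehari V" for z
  proof -
    define m where "m = mass z"
    have z: "admissible V z" "m > 0" "action V z = m"
      using that by (auto simp: nehari_iff[of V, OF V] m_def)
    \<comment> \<open>On the Nehari manifold the action is the mass, so \<open>action_ge\<close> becomes a lower bound for the mass.\<close>
    have "m * min_action V - m * ln m \<le> m" using action_ge[of V, OF V z(1)] z(3) by (simp add: m_def)
    then have "m * c \<le> m * ln m" by (simp add: c_def algebra_simps)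
    then have "exp c \<le> m" using z(2) by (simp add: ln_ge_iff)
    then show ?thesis using z by (simp add: Ju energy_eq_action)
  qed
  then have "energy V u = (INF z\<in>nehari V. energy V z)"
    using u_nehari by (intro antisym INF_greatest INF_lower) auto
  moreover have "u \<in> energy_domain V" using u_nehari by (simp add: nehari_def)
  moreover have "u x > 0" for x using w_pos[of x] a by (simp add: u_def)
  moreover have "u \<noteq> (\<lambda>x. 0)" using u_nehari by (simp add: nehari_def)
  ultimately show ?thesis
    using solves by (intro exI[of _ u]) (simp add: ground_state_def is_solution_def)
qed

end
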